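(* Let $\mathcal{T}=(\mathcal{V},\mathcal{E})$ be a tree with $|\mathcal{V}|=d$, let $\lambda>0$ and $\boldsymbol{\alpha}=(\alpha_e,\,e\in\mathcal{E})\in(0,1)^{d-1}$, let $\boldsymbol{N}=(N_j,\,j\in\mathcal{V})\sim\mathrm{MPMRF}(\lambda,\boldsymbol{\alpha},\mathcal{T})$ and $M=\sum_{j\in\mathcal{V}}N_j$. Let $v,w\in\mathcal{V}$, and let $H_v^{\mathcal{T}_v}$ and $H_w^{\mathcal{T}_w}$ be discrete random variables with probability generating functions $t\mapsto\eta_v^{\mathcal{T}_v}(t)$ and $t\mapsto\eta_w^{\mathcal{T}_w}(t)$, $t\in[-1,1]$, respectively (tree $\mathcal{T}$ rooted at $v$, respectively at $w$). If $H_v^{\mathcal{T}_v}\preceq_{st}H_w^{\mathcal{T}_w}$, then $(N_v,M)\preceq_{sm}(N_w,M)$, that is, $N_v$ is less contributing than $N_w$ to $M$.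
   Context: Trees and rootings. A tree $\mathcal{T}=(\mathcal{V},\mathcal{E})$ is a finite simple undirected graph in which any two vertices are joined by exactly one path; edges are undirected. For $r\in\mathcal{V}$, $\mathcal{T}_r$ is $\mathcal{T}$ rooted at $r$. In $\mathcal{T}_r$: $\mathrm{dsc}(v)$ is the set of vertices $u\neq v$ such that $v$ lies on the path from $u$ to $r$; $\mathrm{ch}(v)$ is the set of $j\in\mathrm{dsc}(v)$ with $(v,j)\in\mathcal{E}$; $\mathrm{pa}(v)$, for $v\ne r$, is the unique neighbour of $v$ that is not a child of $v$. The family MPMRF. For a count random variable $N$ and $\alpha\in[0,1]$, binomial thinning is $\alpha\circ N=\sum_{i=1}^{N}I_i^{(\alpha)}$ with $(I_i^{(\alpha)})_i$ i.i.d. Bernoulli($\alpha$), independent of $N$ (the empty sum is $0$); thinnings attached to different edges use independent Bernoulli variables. Given a tree $\mathcal{T}$, $\lambda>0$ and $\boldsymbol{\alpha}=(\alpha_e,e\in\mathcal{E})$, choose a root $r$ and let $(L_v,v\in\mathcal{V})$ be independent (and independent of all thinning variables) with $L_r\sim\mathrm{Poisson}(\lambda)$ and $L_v\sim\mathrm{Poisson}(\lambda(1-\alpha_{(\mathrm{pa}(v),v)}))$ for $v\neq r$. Set $N_r=L_r$ and $N_v=L_v+\alpha_{(\mathrm{pa}(v),v)}\circ N_{\mathrm{pa}(v)}$ for $v\ne r$, recursively down the tree. The law of $\boldsymbol{N}=(N_v,v\in\mathcal{V})$ does not depend on the chosen root; one writes $\boldsymbol{N}\sim\mathrm{MPMRF}(\lambda,\boldsymbol{\alpha},\mathcal{T})$.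 All marginals are $\mathrm{Poisson}(\lambda)$. The functions $\eta$. For the rooted tree $\mathcal{T}_r$ with parameters $\boldsymbol{\alpha}$, define recursively $\eta_v^{\mathcal{T}_r}(t)=t\prod_{j\in\mathrm{ch}(v)}\bigl(1-\alpha_{(v,j)}+\alpha_{(v,j)}\,\eta_j^{\mathcal{T}_r}(t)\bigr)$, with $\eta_v^{\mathcal{T}_r}(t)=t$ if $\mathrm{ch}(v)=\emptyset$ (children taken in $\mathcal{T}_r$). Each is the probability generating function of a discrete random variable. Orders. $X\preceq_{st}Y$ (usual stochastic order) means $\Pr(X>x)\le\Pr(Y>x)$ for all $x\in\mathbb{R}$. For random vectors, $\boldsymbol{X}\preceq_{sm}\boldsymbol{X}'$ means $\mathrm{E}[\zeta(\boldsymbol{X})]\le\mathrm{E}[\zeta(\boldsymbol{X}')]$ for every supermodular $\zeta$ (i.e. $\zeta(\boldsymbol{x})+\zeta(\boldsymbol{x}')\le\zeta(\boldsymbol{x}\wedge\boldsymbol{x}')+\zeta(\boldsymbol{x}\vee\boldsymbol{x}')$ for all $\boldsymbol{x},\boldsymbol{x}'$, with componentwise minimum and maximum) for which the expectations exist. For a random vector $\boldsymbol{X}=(X_j,j\in\mathcal{V})$ with sum $S$, $X_v$ is called less contributing than $X_w$ to $S$ if $(X_v,S)\preceq_{sm}(X_w,S)$. *)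

theory Defs
  imports "HOL-Probability.Probability"
begin

section \<open>Trees and rootings\<close>

text \<open>Edges are two-element vertex sets, so an edge parameter \<open>\<alpha>\<close> is a function on vertex sets and
  is automatically symmetric in the endpoints.\<close>

definition is_path :: "'a set \<Rightarrow> 'a set set \<Rightarrow> 'a \<Rightarrow> 'a \<Rightarrow> 'a list \<Rightarrow> bool" where
  "is_path V E u v p \<longleftrightarrow> p \<noteq> [] \<and> hd p = u \<and> last p = v \<and> distinct p \<and> set p \<subseteq> V
     \<and> successively (\<lambda>x y. {x, y} \<in> E) p"

locale undirected_tree =
  fixes V :: "'a set" and E :: "'a set set"
  assumes finite_vertices: "finite V"
    and simple_edges: "E \<subseteq> {{x, y} |x y. x \<in> V \<and> y \<in> V \<and> x \<noteq> y}"
    and unique_path: "\<And>u v. u \<in> V \<Longrightarrow> v \<in> V \<Longrightarrow> \<exists>!p. is_path V E u v p"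
begin

definition the_path :: "'a \<Rightarrow> 'a \<Rightarrow> 'a list" where
  "the_path u v = (THE p. is_path V E u v p)"

lemma is_path_the_path: "u \<in> V \<Longrightarrow> v \<in> V \<Longrightarrow> is_path V E u v (the_path u v)"
  unfolding the_path_def by (rule theI') (rule unique_path)

lemma path_eqI: "u \<in> V \<Longrightarrow> v \<in> V \<Longrightarrow> is_path V E u v p \<Longrightarrow> the_path u v = p"
  using is_path_the_path unique_path by blast

lemma path_suffix:
  assumes "u \<in> V" "v \<in> V" "the_path u v = xs @ w # ys"
  shows "the_path w v = w # ys"
proof (rule path_eqI)
  have *: "is_path V E u v (xs @ w # ys)"
    using is_path_the_path[OF assms(1,2)] assms(3) by simp
  then show "is_path V E w v (w # ys)" "w \<in> V"
    by (auto simp: is_path_def successively_append_iff)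
qed (rule assms)

end

locale rooted_tree = undirected_tree +
  fixes r :: 'a
  assumes root: "r \<in> V"
begin

definition dsc :: "'a \<Rightarrow> 'a set" where
  "dsc v = {u \<in> V. u \<noteq> v \<and> v \<in> set (the_path u r)}"

definition ch :: "'a \<Rightarrow> 'a set" where
  "ch v = {j \<in> dsc v. {v, j} \<in> E}"

text \<open>Only meaningful for a vertex \<open>v \<noteq> r\<close>.\<close>
definition pa :: "'a \<Rightarrow> 'a" where
  "pa v = (THE u. {v, u} \<in> E \<and> u \<notin> ch v)"

lemma finite_dsc: "finite (dsc v)"
  using finite_vertices by (simp add: dsc_def)

lemma dscE:
  assumes "u \<in> dsc v"
  obtains xs ys where "u \<in> V" "v \<in> V" "xs \<noteq> []" "the_path u r = xs @ v # ys" "the_path v r = v # ys"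
proof -
  have u: "u \<in> V" "u \<noteq> v" and "v \<in> set (the_path u r)"
    using assms by (auto simp: dsc_def)
  then obtain xs ys where eq: "the_path u r = xs @ v # ys"
    by (meson split_list)
  moreover have "xs \<noteq> []" "v \<in> V"
    using is_path_the_path[OF u(1) root] eq u(2) by (auto simp: is_path_def)
  ultimately show ?thesis
    using that u(1) path_suffix[OF u(1) root eq] by blast
qed

lemma dsc_length: "u \<in> dsc v \<Longrightarrow> length (the_path v r) < length (the_path u r)"
  by (erule dscE) simp

lemma dsc_trans:
  assumes "u \<in> dsc v" "v \<in> dsc w"
  shows "u \<in> dsc w"
proof -
  obtain xs ys where 1: "the_path u r = xs @ v # ys" "the_path v r = v # ys" "u \<in> V"
    using assms(1) by (rule dscE)
  have "w \<in> set (the_path v r)"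
    using assms(2) by (simp add: dsc_def)
  then have "w \<in> set (the_path u r)"
    unfolding 1 by auto
  moreover have "u \<noteq> w"
    using dsc_length[OF assms(1)] dsc_length[OF assms(2)] by auto
  ultimately show ?thesis
    using 1(3) by (simp add: dsc_def)
qed

lemma card_dsc_ch:
  assumes "j \<in> ch v"
  shows "card (dsc j) < card (dsc v)"
proof (rule psubset_card_mono[OF finite_dsc])
  have j: "j \<in> dsc v"
    using assms by (simp add: ch_def)
  moreover have "j \<notin> dsc j"
    by (simp add: dsc_def)
  ultimately show "dsc j \<subset> dsc v"
    using dsc_trans[OF _ j] by blast
qed

lemma parent_unique:
  assumes v: "v \<in> V" "v \<noteq> r"
  shows "\<exists>!u. {v, u} \<in> E \<and> u \<notin> ch v"
    and "{v, u} \<in> E \<Longrightarrow> u \<notin> ch v \<Longrightarrow> the_path v r = v # the_path u r"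
proof -
  have P: "is_path V E v r (the_path v r)"
    by (rule is_path_the_path[OF v(1) root])
  then obtain x xs where eq: "the_path v r = v # x # xs"
    using v(2) unfolding is_path_def
    by (metis last_ConsL list.collapse list.exhaust_sel)
  have x: "{v, x} \<in> E" "x \<in> V"
    using P eq by (auto simp: is_path_def)
  have px: "the_path x r = x # xs"
    using path_suffix[OF v(1) root, of "[v]" x xs] eq by simp
  have "x \<notin> ch v"
    using px P eq by (auto simp: ch_def dsc_def is_path_def)
  moreover have ux: "u = x" if u: "{v, u} \<in> E" "u \<notin> ch v" for u
  proof -
    have uV: "u \<in> V" "u \<noteq> v"
      using u(1) simple_edges by (fastforce simp: doubleton_eq_iff)+
    have in_path: "u \<in> set (the_path v r)"
    proof (rule ccontr)
      assume "u \<notin> set (the_path v r)"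
      then have "is_path V E u r (u # the_path v r)"
        using P u(1) uV eq by (auto simp: is_path_def insert_commute)
      then have "the_path u r = u # the_path v r"
        by (rule path_eqI[OF uV(1) root])
      then show False
        using u uV eq by (auto simp: ch_def dsc_def)
    qed
    then obtain as bs where ab: "x # xs = as @ u # bs"
      using uV eq by (metis set_ConsD split_list)
    have "is_path V E v u (v # as @ [u])"
      using P ab unfolding eq ab by (auto simp: is_path_def successively_append_iff successively_Cons hd_append)
    moreover have "is_path V E v u [v, u]"
      using v uV u by (auto simp: is_path_def)
    ultimately have "v # as @ [u] = [v, u]"
      using unique_path[OF v(1) uV(1)] by blast
    then show ?thesis
      using ab by simp
  qed
  ultimately show "\<exists>!u. {v, u} \<in> E \<and> u \<notin> ch v"
    using x by blast
  show "the_path v r = v # the_path u r" if "{v, u} \<in> E" "u \<notin> ch v"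
    using ux[OF that] eq px by simp
qed

lemma path_pa: "v \<in> V \<Longrightarrow> v \<noteq> r \<Longrightarrow> the_path v r = v # the_path (pa v) r"
  using theI'[OF parent_unique(1)] parent_unique(2) unfolding pa_def by blast


section \<open>The functions \<open>\<eta>\<close>\<close>

function eta :: "('a set \<Rightarrow> real) \<Rightarrow> 'a \<Rightarrow> real \<Rightarrow> real" where
  "eta \<alpha> v t = t * (\<Prod>j\<in>ch v. 1 - \<alpha> {v, j} + \<alpha> {v, j} * eta \<alpha> j t)"
  by auto
termination
  by (relation "Wellfounded.measure (\<lambda>(\<alpha>, v, t). card (dsc v))") (auto intro: card_dsc_ch)

declare eta.simps [simp del]


section \<open>The law MPMRF\<close>

text \<open>A pair \<open>(L, I)\<close> is a realisation of the variables \<open>L\<^sub>v\<close> and of the Bernoulli variables,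
  \<open>I (e, i)\<close> being the \<open>i\<close>-th Bernoulli variable of the edge \<open>e\<close>; the sum below is the
  thinning of the count at the parent.\<close>

function mpmrf_count :: "('a \<Rightarrow> nat) \<Rightarrow> ('a set \<times> nat \<Rightarrow> bool) \<Rightarrow> 'a \<Rightarrow> nat" where
  "mpmrf_count L I v =
     (if v \<in> V - {r} then L v + (\<Sum>i<mpmrf_count L I (pa v). of_bool (I ({pa v, v}, i))) else L v)"
  by auto
termination
  by (relation "Wellfounded.measure (\<lambda>(L, I, v). length (the_path v r))") (auto simp: path_pa)

declare mpmrf_count.simps [simp del]

text \<open>All coordinates are independent.  The rates are positive, as \<^const>\<open>poisson_pmf\<close> requires,
  when \<open>lam > 0\<close> and \<open>0 \<le> \<alpha> e < 1\<close> for all edges \<open>e\<close>.\<close>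
definition source_space ::
    "real \<Rightarrow> ('a set \<Rightarrow> real) \<Rightarrow> (('a \<Rightarrow> nat) \<times> ('a set \<times> nat \<Rightarrow> bool)) measure" where
  "source_space lam \<alpha> =
     (\<Pi>\<^sub>M v\<in>V. measure_pmf (poisson_pmf (if v = r then lam else lam * (1 - \<alpha> {pa v, v}))))
     \<Otimes>\<^sub>M (\<Pi>\<^sub>M (e, i)\<in>E \<times> UNIV. measure_pmf (bernoulli_pmf (\<alpha> e)))"

definition mpmrf_law :: "real \<Rightarrow> ('a set \<Rightarrow> real) \<Rightarrow> ('a \<Rightarrow> nat) measure" where
  "mpmrf_law lam \<alpha> =
     distr (source_space lam \<alpha>) (\<Pi>\<^sub>M v\<in>V. count_space UNIV) (\<lambda>(L, I). \<lambda>v\<in>V. mpmrf_count L I v)"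

end

text \<open>The random vector \<open>N = (N\<^sub>v, v \<in> V)\<close> on \<open>P\<close> has the law obtained from some choice of the root.\<close>
definition mpmrf ::
    "'w measure \<Rightarrow> ('a \<Rightarrow> 'w \<Rightarrow> nat) \<Rightarrow> real \<Rightarrow> ('a set \<Rightarrow> real) \<Rightarrow> 'a set \<Rightarrow> 'a set set \<Rightarrow> bool" where
  "mpmrf P N lam \<alpha> V E \<longleftrightarrow>
     (\<forall>v\<in>V. N v \<in> P \<rightarrow>\<^sub>M count_space UNIV) \<and>
     (\<exists>r\<in>V. distr P (\<Pi>\<^sub>M v\<in>V. count_space UNIV) (\<lambda>\<omega>. \<lambda>v\<in>V. N v \<omega>)
              = rooted_tree.mpmrf_law V E r lam \<alpha>)"


section \<open>Probability generating functions and stochastic orders\<close>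

definition pgf :: "'w measure \<Rightarrow> ('w \<Rightarrow> nat) \<Rightarrow> real \<Rightarrow> real" where
  "pgf P X t = (\<integral>\<omega>. t ^ X \<omega> \<partial>P)"

definition st_le :: "'w measure \<Rightarrow> ('w \<Rightarrow> real) \<Rightarrow> 'w2 measure \<Rightarrow> ('w2 \<Rightarrow> real) \<Rightarrow> bool" where
  "st_le P X Q Y \<longleftrightarrow> (\<forall>x. \<P>(\<omega> in P. X \<omega> > x) \<le> \<P>(\<omega> in Q. Y \<omega> > x))"

text \<open>In the class \<open>ordered_euclidean_space\<close>, which contains \<open>real \<times> real\<close>, the operations
  \<^const>\<open>inf\<close> and \<^const>\<open>sup\<close> are the componentwise minimum and maximum.\<close>
definition supermodular :: "('b::ordered_euclidean_space \<Rightarrow> real) \<Rightarrow> bool" where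
  "supermodular \<zeta> \<longleftrightarrow> (\<forall>x y. \<zeta> x + \<zeta> y \<le> \<zeta> (inf x y) + \<zeta> (sup x y))"

definition sm_le ::
    "'w measure \<Rightarrow> ('w \<Rightarrow> 'b::ordered_euclidean_space) \<Rightarrow> 'w2 measure \<Rightarrow> ('w2 \<Rightarrow> 'b) \<Rightarrow> bool" where
  "sm_le P X Q Y \<longleftrightarrow>
     (\<forall>\<zeta>. supermodular \<zeta> \<longrightarrow> integrable P (\<lambda>\<omega>. \<zeta> (X \<omega>)) \<longrightarrow> integrable Q (\<lambda>\<omega>. \<zeta> (Y \<omega>)) \<longrightarrow>
        (\<integral>\<omega>. \<zeta> (X \<omega>) \<partial>P) \<le> (\<integral>\<omega>. \<zeta> (Y \<omega>) \<partial>Q))"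

text \<open>\<open>X\<^sub>v\<close> is less contributing than \<open>X\<^sub>w\<close> to the sum of \<open>(X\<^sub>j, j \<in> V)\<close>.\<close>
definition less_contributing ::
    "'w measure \<Rightarrow> 'a set \<Rightarrow> ('a \<Rightarrow> 'w \<Rightarrow> real) \<Rightarrow> 'a \<Rightarrow> 'a \<Rightarrow> bool" where
  "less_contributing P V X v w \<longleftrightarrow>
     sm_le P (\<lambda>\<omega>. (X v \<omega>, \<Sum>j\<in>V. X j \<omega>)) P (\<lambda>\<omega>. (X w \<omega>, \<Sum>j\<in>V. X j \<omega>))"

end

theory Submission
  imports Defs "HOL-Complex_Analysis.Cauchy_Integral_Formula"
begin

text \<open>
  Think of the population counted by \<open>N\<close> as split into clusters: each individual that is newly created at a
  vertex, together with all the individuals that survive from it along the edges away from the root.  The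
  clusters that start at \<open>u\<close> are Poisson in number and their sizes have the generating function \<open>\<eta>\<^sub>u\<close>.
  Choose the vertex \<open>v\<close> as root.  A cluster contains an individual at \<open>v\<close> only if it starts
  there, and then exactly one.  The pair of \<open>N\<^sub>v\<close> and the total \<open>M\<close> is thus a compound Poisson sum of
  independent clusters, each contributing its size to \<open>M\<close> and a mark, 0 or 1, to \<open>N\<^sub>v\<close>
  (\<open>mpmrf_compound_poisson\<close>).  Marked clusters have the size \<open>H\<^sub>v\<close>.

  For two roots \<open>v\<close> and \<open>w\<close>, the number of clusters, the law of their sizes and the probability of a mark
  agree; only the clusters that carry the marks differ, and their sizes have the laws of \<open>H\<^sub>v\<close> and
  \<open>H\<^sub>w\<close>.  If \<open>H\<^sub>v\<close> is stochastically smaller than \<open>H\<^sub>w\<close>, moving the root from \<open>v\<close> to \<open>w\<close> moves the marks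
  to larger clusters, and this increases the single-cluster law in the supermodular order
  (\<open>sm_le_pmf_marked_mixture\<close>).  The order is preserved by convolution and by mixing over the Poisson number
  of clusters (\<open>sm_le_pmf_conv\<close>, \<open>compound_poisson_sm_mono\<close>), which gives the theorem.

  The compound Poisson representation is read off from generating functions.  Integrating out leaves one after
  another shows that, for the root that defines the law, the joint generating function of \<open>N\<close> is the
  exponential of an explicit sum over the vertices, up to a constant factor
  (\<open>expectation_thinnings\<close>, \<open>expectation_source_space\<close>).  That sum does not change when the root moves along an
  edge (\<open>pgf_exponent_eq\<close>), so it may be evaluated for the root \<open>v\<close> or \<open>w\<close>.
\<close>

section \<open>Expectations under mixtures\<close>

text \<open>The supermodular functions of interest are neither bounded nor nonnegative, so the integral formula for
  mixtures is needed under mere integrability.  Tonelli settles the nonnegative case; positive and negative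
  parts give the general one.\<close>

lemma expectation_bind_pmf_nonneg:
  fixes f :: "'b \<Rightarrow> real"
  assumes f: "integrable (measure_pmf (bind_pmf M N)) f" and nonneg: "\<And>y. 0 \<le> f y"
  shows "AE x in measure_pmf M. integrable (measure_pmf (N x)) f"
    and "has_bochner_integral (measure_pmf M) (\<lambda>x. measure_pmf.expectation (N x) f)
           (measure_pmf.expectation (bind_pmf M N) f)"
proof -
  have eq: "(\<integral>\<^sup>+x. \<integral>\<^sup>+y. f y \<partial>N x \<partial>M) = ennreal (measure_pmf.expectation (bind_pmf M N) f)"
    using nn_integral_eq_integral[OF f] nonneg by simp
  then have "AE x in measure_pmf M. (\<integral>\<^sup>+y. f y \<partial>N x) \<noteq> \<infinity>"
    by (intro nn_integral_PInf_AE) auto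
  then show int: "AE x in measure_pmf M. integrable (measure_pmf (N x)) f"
    by eventually_elim (use nonneg in \<open>auto simp: integrable_iff_bounded top.not_eq_extremum\<close>)
  have "(\<integral>\<^sup>+x. ennreal (measure_pmf.expectation (N x) f) \<partial>M) = (\<integral>\<^sup>+x. \<integral>\<^sup>+y. f y \<partial>N x \<partial>M)"
    using int by (intro nn_integral_cong_AE, eventually_elim) (simp add: nn_integral_eq_integral nonneg)
  then show "has_bochner_integral (measure_pmf M) (\<lambda>x. measure_pmf.expectation (N x) f)
           (measure_pmf.expectation (bind_pmf M N) f)"
    using eq by (intro has_bochner_integral_nn_integral) (auto simp: nonneg)
qed

lemma has_bochner_integral_bind_pmf:
  fixes f :: "'b \<Rightarrow> real"
  assumes f: "integrable (measure_pmf (bind_pmf M N)) f"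
  shows "has_bochner_integral (measure_pmf M) (\<lambda>x. measure_pmf.expectation (N x) f)
           (measure_pmf.expectation (bind_pmf M N) f)"
proof -
  let ?p = "\<lambda>y. max (f y) 0" and ?n = "\<lambda>y. max (- f y) 0"
  have ip: "integrable (measure_pmf (bind_pmf M N)) ?p" "integrable (measure_pmf (bind_pmf M N)) ?n"
    using f by auto
  note P = expectation_bind_pmf_nonneg[OF ip(1)] and Q = expectation_bind_pmf_nonneg[OF ip(2)]
  have f_eq: "f = (\<lambda>y. ?p y - ?n y)"
    by auto
  have "has_bochner_integral (measure_pmf M)
      (\<lambda>x. measure_pmf.expectation (N x) ?p - measure_pmf.expectation (N x) ?n)
      (measure_pmf.expectation (bind_pmf M N) ?p - measure_pmf.expectation (bind_pmf M N) ?n)"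
    by (intro has_bochner_integral_diff P(2) Q(2)) auto
  also have "measure_pmf.expectation (bind_pmf M N) ?p - measure_pmf.expectation (bind_pmf M N) ?n
      = measure_pmf.expectation (bind_pmf M N) f"
    by (subst (3) f_eq, rule Bochner_Integration.integral_diff[symmetric, OF ip])
  finally show ?thesis
  proof (rule has_bochner_integral_cong_AE[THEN iffD1, rotated -1])
    have "AE x in measure_pmf M. integrable (measure_pmf (N x)) ?p"
         "AE x in measure_pmf M. integrable (measure_pmf (N x)) ?n"
      using P(1) Q(1) by auto
    then show "AE x in measure_pmf M. measure_pmf.expectation (N x) ?p - measure_pmf.expectation (N x) ?n
        = measure_pmf.expectation (N x) f"
      by eventually_elim (subst (3) f_eq, simp add: Bochner_Integration.integral_diff)
  qed auto
qed

section \<open>Compound Poisson laws\<close>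

definition conv_pmf :: "'a::plus pmf \<Rightarrow> 'a pmf \<Rightarrow> 'a pmf" where
  "conv_pmf p q = bind_pmf p (\<lambda>x. map_pmf ((+) x) q)"

primrec conv_power :: "'a::monoid_add pmf \<Rightarrow> nat \<Rightarrow> 'a pmf" where
  "conv_power p 0 = return_pmf 0"
| "conv_power p (Suc k) = conv_pmf p (conv_power p k)"

definition compound_poisson :: "real \<Rightarrow> 'a::monoid_add pmf \<Rightarrow> 'a pmf" where
  "compound_poisson c p = bind_pmf (poisson_pmf c) (conv_power p)"

lemma finite_set_conv_pmf: "finite (set_pmf p) \<Longrightarrow> finite (set_pmf q) \<Longrightarrow> finite (set_pmf (conv_pmf p q))"
  by (simp add: conv_pmf_def)

lemma finite_set_conv_power: "finite (set_pmf p) \<Longrightarrow> finite (set_pmf (conv_power p k))"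
  by (induction k) (auto intro: finite_set_conv_pmf)

lemma expectation_conv_pmf:
  fixes f :: "'a::plus \<Rightarrow> real"
  assumes "finite (set_pmf p)" "finite (set_pmf q)"
  shows "measure_pmf.expectation (conv_pmf p q) f
           = measure_pmf.expectation p (\<lambda>x. measure_pmf.expectation q (\<lambda>y. f (x + y)))"
  using has_bochner_integral_bind_pmf[of p "\<lambda>x. map_pmf ((+) x) q" f] assms
  by (simp add: conv_pmf_def has_bochner_integral_iff integrable_measure_pmf_finite)

text \<open>A function turning sums into products turns convolutions into products of expectations.  For
  \<open>\<phi> (n, m) = s ^ n * t ^ m\<close> the expectations are bivariate probability generating functions.\<close>

lemma expectation_conv_power_character:
  fixes \<phi> :: "'a::monoid_add \<Rightarrow> real"
  assumes fin: "finite (set_pmf p)" and \<phi>: "\<phi> 0 = 1" "\<And>x y. \<phi> (x + y) = \<phi> x * \<phi> y"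
  shows "measure_pmf.expectation (conv_power p k) \<phi> = measure_pmf.expectation p \<phi> ^ k"
  by (induction k) (simp_all add: \<phi> expectation_conv_pmf fin finite_set_conv_power)

lemma expectation_poisson_power:
  assumes c: "0 < c" and q: "\<bar>q\<bar> \<le> (1::real)"
  shows "measure_pmf.expectation (poisson_pmf c) (\<lambda>n. q ^ n) = exp (c * (q - 1))"
proof -
  have "integrable (measure_pmf (poisson_pmf c)) (\<lambda>n. q ^ n)"
    using q by (intro measure_pmf.integrable_const_bound[where B=1]) (auto simp: power_le_one power_abs)
  then have "integrable (count_space UNIV) (\<lambda>n. pmf (poisson_pmf c) n *\<^sub>R q ^ n)"
    unfolding measure_pmf_eq_density by (subst (asm) integrable_density) auto
  then have "(\<lambda>n. pmf (poisson_pmf c) n *\<^sub>R q ^ n) sums measure_pmf.expectation (poisson_pmf c) (\<lambda>n. q ^ n)"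
    unfolding measure_pmf_eq_density by (subst integral_density) (auto intro!: sums_integral_count_space_nat)
  moreover have "(\<lambda>n. exp (-c) * ((c * q) ^ n /\<^sub>R fact n)) sums (exp (-c) * exp (c * q))"
    by (intro sums_mult exp_converges)
  then have "(\<lambda>n. pmf (poisson_pmf c) n *\<^sub>R q ^ n) sums (exp (-c) * exp (c * q))"
    using c by (simp add: power_mult_distrib field_simps)
  ultimately show ?thesis
    by (simp add: sums_unique2[of "\<lambda>n. pmf (poisson_pmf c) n *\<^sub>R q ^ n"] algebra_simps flip: exp_add)
qed

lemma expectation_compound_poisson_character:
  fixes \<phi> :: "'a::monoid_add \<Rightarrow> real"
  assumes "0 < c" and fin: "finite (set_pmf p)"
    and \<phi>: "\<phi> 0 = 1" "\<And>x y. \<phi> (x + y) = \<phi> x * \<phi> y" "\<And>x. \<bar>\<phi> x\<bar> \<le> 1"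
  shows "measure_pmf.expectation (compound_poisson c p) \<phi> = exp (c * (measure_pmf.expectation p \<phi> - 1))"
proof -
  let ?g = "measure_pmf.expectation p \<phi>"
  have "integrable (measure_pmf (compound_poisson c p)) \<phi>"
    using \<phi>(3) by (intro measure_pmf.integrable_const_bound[where B=1]) auto
  then have "measure_pmf.expectation (compound_poisson c p) \<phi> = measure_pmf.expectation (poisson_pmf c) (\<lambda>n. ?g ^ n)"
    using has_bochner_integral_bind_pmf[of "poisson_pmf c" "conv_power p" \<phi>]
    by (simp add: compound_poisson_def has_bochner_integral_iff expectation_conv_power_character fin \<phi>)
  also have "\<bar>?g\<bar> \<le> 1"
  proof -
    have "\<bar>?g\<bar> \<le> measure_pmf.expectation p (\<lambda>x. \<bar>\<phi> x\<bar>)"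
      by simp
    also have "\<dots> \<le> measure_pmf.expectation p (\<lambda>x. 1)"
      using \<phi>(3) fin by (intro integral_mono integrable_measure_pmf_finite) auto
    finally show ?thesis by simp
  qed
  then have "measure_pmf.expectation (poisson_pmf c) (\<lambda>n. ?g ^ n) = exp (c * (?g - 1))"
    by (rule expectation_poisson_power[OF \<open>0 < c\<close>])
  finally show ?thesis .
qed

section \<open>The supermodular order on finitely supported laws\<close>

definition supermod_nat :: "(nat \<times> nat \<Rightarrow> real) \<Rightarrow> bool" where
  "supermod_nat f \<longleftrightarrow> (\<forall>a a' b b'. a \<le> a' \<longrightarrow> b \<le> b' \<longrightarrow> f (a, b') + f (a', b) \<le> f (a, b) + f (a', b'))"

text \<open>Finiteness of the supports makes every expectation exist, so the order can be composed freely;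
  integrability only matters again for Poisson mixtures.\<close>

definition sm_le_pmf :: "(nat \<times> nat) pmf \<Rightarrow> (nat \<times> nat) pmf \<Rightarrow> bool" where
  "sm_le_pmf p q \<longleftrightarrow> finite (set_pmf p) \<and> finite (set_pmf q) \<and>
     (\<forall>f. supermod_nat f \<longrightarrow> measure_pmf.expectation p f \<le> measure_pmf.expectation q f)"

lemma supermod_nat_translate: "supermod_nat f \<Longrightarrow> supermod_nat (\<lambda>y. f (x + y))"
  by (cases x) (simp add: supermod_nat_def)

lemma supermod_nat_expectation:
  assumes f: "supermod_nat f" and q: "finite (set_pmf q)"
  shows "supermod_nat (\<lambda>x. measure_pmf.expectation q (\<lambda>y. f (x + y)))"
  unfolding supermod_nat_def
proof (intro allI impI)
  fix a a' b b' :: nat assume le: "a \<le> a'" "b \<le> b'"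
  let ?E = "\<lambda>x. measure_pmf.expectation q (\<lambda>y. f (x + y))"
  have I: "integrable (measure_pmf q) h" for h :: "nat \<times> nat \<Rightarrow> real"
    using q by (rule integrable_measure_pmf_finite)
  have "measure_pmf.expectation q (\<lambda>y. f ((a, b') + y) + f ((a', b) + y))
      \<le> measure_pmf.expectation q (\<lambda>y. f ((a, b) + y) + f ((a', b') + y))"
    using f le by (intro integral_mono I) (auto simp: supermod_nat_def)
  then show "?E (a, b') + ?E (a', b) \<le> ?E (a, b) + ?E (a', b')"
    by (simp add: I)
qed

text \<open>The summands can be replaced one at a time: fixing one summand at \<open>x\<close> leaves a translate of \<open>f\<close>, and
  averaging translates of \<open>f\<close> over the other summand leaves a supermodular function.\<close>

lemma sm_le_pmf_conv:
  assumes "sm_le_pmf p p'" "sm_le_pmf q q'"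
  shows "sm_le_pmf (conv_pmf p q) (conv_pmf p' q')"
  unfolding sm_le_pmf_def
proof (intro conjI allI impI)
  have fin: "finite (set_pmf p)" "finite (set_pmf p')" "finite (set_pmf q)" "finite (set_pmf q')"
    using assms by (auto simp: sm_le_pmf_def)
  then show "finite (set_pmf (conv_pmf p q))" "finite (set_pmf (conv_pmf p' q'))"
    by (auto intro: finite_set_conv_pmf)
  fix f assume f: "supermod_nat f"
  have "measure_pmf.expectation (conv_pmf p q) f
      \<le> measure_pmf.expectation p (\<lambda>x. measure_pmf.expectation q' (\<lambda>y. f (x + y)))"
    unfolding expectation_conv_pmf[OF fin(1,3)] using assms(2) fin supermod_nat_translate[OF f]
    by (intro integral_mono integrable_measure_pmf_finite) (auto simp: sm_le_pmf_def)
  also have "\<dots> \<le> measure_pmf.expectation p' (\<lambda>x. measure_pmf.expectation q' (\<lambda>y. f (x + y)))"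
    using assms(1) supermod_nat_expectation[OF f fin(4)] by (simp add: sm_le_pmf_def)
  also have "\<dots> = measure_pmf.expectation (conv_pmf p' q') f"
    by (rule expectation_conv_pmf[OF fin(2,4), symmetric])
  finally show "measure_pmf.expectation (conv_pmf p q) f \<le> measure_pmf.expectation (conv_pmf p' q') f" .
qed

lemma sm_le_pmf_conv_power: "sm_le_pmf p q \<Longrightarrow> sm_le_pmf (conv_power p k) (conv_power q k)"
  by (induction k) (auto intro: sm_le_pmf_conv simp: sm_le_pmf_def[of "return_pmf _"])

text \<open>Both laws mix the convolution powers with the same Poisson weights, so the comparison of the powers
  can be integrated.\<close>

lemma compound_poisson_sm_mono:
  assumes "sm_le_pmf p q" and f: "supermod_nat f"
    and int: "integrable (measure_pmf (compound_poisson c p)) f" "integrable (measure_pmf (compound_poisson c q)) f"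
  shows "measure_pmf.expectation (compound_poisson c p) f \<le> measure_pmf.expectation (compound_poisson c q) f"
proof -
  note I = int[unfolded compound_poisson_def, THEN has_bochner_integral_bind_pmf, unfolded has_bochner_integral_iff]
  show ?thesis
    unfolding compound_poisson_def I(1)[THEN conjunct2, symmetric] I(2)[THEN conjunct2, symmetric]
    using I sm_le_pmf_conv_power[OF assms(1)] f
    by (intro integral_mono) (auto simp: sm_le_pmf_def)
qed

text \<open>Summation by parts writes the expectation of \<open>g\<close> as \<open>g 0\<close> plus the sum of the increments
  \<open>g (k + 1) - g k\<close>, nonnegative for monotone \<open>g\<close>, weighted by the tail probabilities.\<close>

lemma expectation_mono_st:
  fixes g :: "nat \<Rightarrow> real"
  assumes fin: "finite (set_pmf p)" "finite (set_pmf q)" and g: "mono g"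
    and tail: "\<And>k. measure_pmf.prob p {k<..} \<le> measure_pmf.prob q {k<..}"
  shows "measure_pmf.expectation p g \<le> measure_pmf.expectation q g"
proof -
  obtain n where n: "set_pmf p \<union> set_pmf q \<subseteq> {..n}"
    using fin finite_nat_iff_bounded_le[of "set_pmf p \<union> set_pmf q"] by auto
  have E: "measure_pmf.expectation r g = g 0 + (\<Sum>k<n. (g (Suc k) - g k) * measure_pmf.prob r {k<..})"
    if r: "set_pmf r \<subseteq> {..n}" for r
  proof -
    have fr: "finite (set_pmf r)"
      using r by (rule finite_subset) simp
    have "g x = g 0 + (\<Sum>k<n. (g (Suc k) - g k) * indicator {k<..} x)" if "x \<le> n" for x
    proof -
      have "(\<Sum>k<n. (g (Suc k) - g k) * indicator {k<..} x) = (\<Sum>k<x. g (Suc k) - g k)"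
        using that by (intro sum.mono_neutral_cong_right) auto
      then show ?thesis by (simp add: sum_lessThan_telescope)
    qed
    then have "AE x in measure_pmf r. g x = g 0 + (\<Sum>k<n. (g (Suc k) - g k) * indicator {k<..} x)"
      unfolding AE_measure_pmf_iff using r by blast
    then have "measure_pmf.expectation r g
        = measure_pmf.expectation r (\<lambda>x. g 0 + (\<Sum>k<n. (g (Suc k) - g k) * indicator {k<..} x))"
      by (intro integral_cong_AE) auto
    also have "\<dots> = g 0 + (\<Sum>k<n. (g (Suc k) - g k) * measure_pmf.prob r {k<..})"
      by (simp add: integrable_measure_pmf_finite[OF fr] Bochner_Integration.integral_sum del: sum_mult_indicator sum_indicator_mult)
    finally show ?thesis .
  qed
  show ?thesis
    using n g tail by (auto simp: E intro!: sum_mono mult_left_mono dest: incseq_SucD)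
qed

text \<open>The law of a single cluster: a type \<open>u\<close> is drawn from \<open>W\<close> and a size from \<open>H u\<close>; the first coordinate
  records whether the type is \<open>v\<close>.\<close>

definition marked_mixture :: "'a pmf \<Rightarrow> ('a \<Rightarrow> nat pmf) \<Rightarrow> 'a \<Rightarrow> (nat \<times> nat) pmf" where
  "marked_mixture W H v = bind_pmf W (\<lambda>u. map_pmf (\<lambda>k. (of_bool (u = v), k)) (H u))"

lemma finite_set_marked_mixture:
  "finite (set_pmf W) \<Longrightarrow> (\<And>u. finite (set_pmf (H u))) \<Longrightarrow> finite (set_pmf (marked_mixture W H v))"
  by (auto simp: marked_mixture_def)

lemma expectation_marked_mixture:
  fixes f :: "nat \<times> nat \<Rightarrow> real"
  assumes W: "finite (set_pmf W)" and H: "\<And>u. finite (set_pmf (H u))"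
  shows "measure_pmf.expectation (marked_mixture W H v) f
    = measure_pmf.expectation W (\<lambda>u. measure_pmf.expectation (H u) (\<lambda>k. f (of_bool (u = v), k)))"
  using has_bochner_integral_bind_pmf[of W "\<lambda>u. map_pmf (\<lambda>k. (of_bool (u = v), k)) (H u)" f] W H
  by (simp add: marked_mixture_def has_bochner_integral_iff integrable_measure_pmf_finite)

text \<open>The core of the comparison.  Marking a cluster of size \<open>k\<close> changes \<open>f\<close> by \<open>f (1, k) - f (0, k)\<close>, and
  supermodularity says exactly that this increment grows with \<open>k\<close>.  When the law of the sizes and the
  probability of a mark agree, only the law of the sizes of the marked clusters matters, and placing the
  marks on stochastically larger clusters increases the expectation.\<close>

lemma sm_le_pmf_marked_mixture:
  assumes W: "finite (set_pmf W)" "finite (set_pmf W')"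
    and H: "\<And>u. finite (set_pmf (H u))" "\<And>u. finite (set_pmf (H' u))"
    and same_size: "bind_pmf W H = bind_pmf W' H'"
    and same_rate: "pmf W v = pmf W' w"
    and tail: "\<And>k. measure_pmf.prob (H v) {k<..} \<le> measure_pmf.prob (H' w) {k<..}"
  shows "sm_le_pmf (marked_mixture W H v) (marked_mixture W' H' w)"
proof -
  have E: "measure_pmf.expectation (marked_mixture W H v) f
      = measure_pmf.expectation (bind_pmf W H) (\<lambda>k. f (0, k))
        + pmf W v * measure_pmf.expectation (H v) (\<lambda>k. f (1, k) - f (0, k))"
    if W: "finite (set_pmf W)" and H: "\<And>u. finite (set_pmf (H u))"
    for W :: "'c pmf" and H v and f :: "nat \<times> nat \<Rightarrow> real"
  proof -
    have I: "integrable (measure_pmf (H u)) h" "integrable (measure_pmf W) h'"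
      for h :: "nat \<Rightarrow> real" and h' :: "'c \<Rightarrow> real" and u
      using W H by (auto intro: integrable_measure_pmf_finite)
    have B: "measure_pmf.expectation (bind_pmf W H) (\<lambda>k. f (0, k))
        = measure_pmf.expectation W (\<lambda>u. measure_pmf.expectation (H u) (\<lambda>k. f (0, k)))"
      using has_bochner_integral_bind_pmf[of W H "\<lambda>k. f (0, k)"] W H
      by (simp add: has_bochner_integral_iff integrable_measure_pmf_finite)
    have "measure_pmf.expectation (H u) (\<lambda>k. f (of_bool (u = v), k))
       = measure_pmf.expectation (H u) (\<lambda>k. f (0, k))
         + measure_pmf.expectation (H v) (\<lambda>k. f (1, k) - f (0, k)) * indicator {v} u" for u
      by (cases "u = v") (auto simp: I)
    then have "measure_pmf.expectation (marked_mixture W H v) f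
        = measure_pmf.expectation W (\<lambda>u. measure_pmf.expectation (H u) (\<lambda>k. f (0, k)))
         + measure_pmf.expectation (H v) (\<lambda>k. f (1, k) - f (0, k)) * measure_pmf.prob W {v}"
      by (simp add: expectation_marked_mixture W H I)
    then show ?thesis
      by (simp add: B pmf.rep_eq)
  qed
  show ?thesis
    unfolding sm_le_pmf_def
  proof (intro conjI allI impI finite_set_marked_mixture W H)
    fix f assume f: "supermod_nat f"
    have "mono (\<lambda>k. f (1, k) - f (0, k))"
    proof (rule monoI)
      fix b b' :: nat assume "b \<le> b'"
      then have "f (0, b') + f (1, b) \<le> f (0, b) + f (1, b')"
        using f by (simp add: supermod_nat_def)
      then show "f (1, b) - f (0, b) \<le> f (1, b') - f (0, b')" by simp
    qed
    then have "measure_pmf.expectation (H v) (\<lambda>k. f (1, k) - f (0, k))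
        \<le> measure_pmf.expectation (H' w) (\<lambda>k. f (1, k) - f (0, k))"
      by (intro expectation_mono_st H tail)
    then show "measure_pmf.expectation (marked_mixture W H v) f \<le> measure_pmf.expectation (marked_mixture W' H' w) f"
      using W H by (simp add: E same_size same_rate mult_left_mono)
  qed
qed

section \<open>Laws are determined by their generating functions\<close>

lemma powser_coeffs_eqI:
  fixes a b :: "nat \<Rightarrow> real"
  assumes "\<And>x. \<bar>x\<bar> < 1 \<Longrightarrow> (\<lambda>n. a n * x ^ n) sums F x" "\<And>x. \<bar>x\<bar> < 1 \<Longrightarrow> (\<lambda>n. b n * x ^ n) sums F x"
  shows "a = b"
proof (rule ccontr)
  assume "a \<noteq> b"
  \<comment> \<open>The shift by one forces the value at 0 to vanish, so that a nonzero coefficient isolates this zero.\<close>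
  define c where "c n = (case n of 0 \<Rightarrow> 0 | Suc n \<Rightarrow> a n - b n)" for n
  obtain m where "a m \<noteq> b m" using \<open>a \<noteq> b\<close> by auto
  then have m: "c (Suc m) \<noteq> 0" by (simp add: c_def)
  have sums: "(\<lambda>n. c n * (x - 0) ^ n) sums 0" if "norm (x - 0) < 1" for x
  proof -
    have "(\<lambda>n. a n * x ^ n - b n * x ^ n) sums 0"
      using sums_diff[OF assms[of x]] that by simp
    from sums_mult[OF this, of x] have "(\<lambda>n. c (Suc n) * x ^ Suc n) sums 0"
      by (simp add: c_def algebra_simps)
    then show ?thesis
      by (subst (asm) sums_Suc_iff) (simp add: c_def)
  qed
  obtain s where "0 < s" "\<And>z::real. z \<in> cball 0 s - {0} \<Longrightarrow> (0::real) \<noteq> 0"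
    using powser_0_nonzero[of 1 0 c "\<lambda>_. 0" "Suc m"] sums m by auto
  from this(2)[of s] this(1) show False by auto
qed

text \<open>The weight \<open>h\<close> makes the expansion usable one variable at a time: for a pair \<open>(X, Y)\<close> one expands
  in powers of \<open>t\<close> with \<open>h = s ^ X\<close>, and then in powers of \<open>s\<close> with \<open>h\<close> the indicator of an event about \<open>Y\<close>.\<close>

lemma (in prob_space) sums_expectation_level_sets:
  fixes h :: "'a \<Rightarrow> real" and t :: real
  assumes [measurable]: "h \<in> borel_measurable M" "Y \<in> M \<rightarrow>\<^sub>M count_space (UNIV :: nat set)"
    and h: "\<And>x. \<bar>h x\<bar> \<le> 1" and t: "\<bar>t\<bar> < 1"
  shows "(\<lambda>n. expectation (\<lambda>x. h x * of_bool (Y x = n)) * t ^ n) sums expectation (\<lambda>x. h x * t ^ Y x)"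
proof -
  have bound: "\<bar>h x * of_bool (Y x = n) * t ^ n\<bar> \<le> \<bar>t\<bar> ^ n" for x n
    using h[of x] by (auto simp: abs_mult power_abs intro!: mult_left_le_one_le)
  have I: "integrable M (\<lambda>x. h x * of_bool (Y x = n) * t ^ n)" for n
    using bound[of _ n] by (intro integrable_const_bound[where B="\<bar>t\<bar> ^ n"]) auto
  have "(\<lambda>n. expectation (\<lambda>x. h x * of_bool (Y x = n) * t ^ n))
      sums expectation (\<lambda>x. \<Sum>n. h x * of_bool (Y x = n) * t ^ n)"
  proof (rule sums_integral[OF I])
    show "AE x in M. summable (\<lambda>n. norm (h x * of_bool (Y x = n) * t ^ n))"
      using bound t by (intro AE_I2 summable_comparison_test'[OF summable_geometric[of "\<bar>t\<bar>"]]) auto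
    have "expectation (\<lambda>x. norm (h x * of_bool (Y x = n) * t ^ n)) \<le> expectation (\<lambda>x. \<bar>t\<bar> ^ n)" for n
      using bound[of _ n] I[of n] by (intro integral_mono) auto
    then show "summable (\<lambda>n. expectation (\<lambda>x. norm (h x * of_bool (Y x = n) * t ^ n)))"
      using t by (intro summable_comparison_test'[OF summable_geometric[of "\<bar>t\<bar>"]]) (auto simp: prob_space)
  qed
  moreover have "(\<Sum>n. h x * of_bool (Y x = n) * t ^ n) = h x * t ^ Y x" for x
    by (subst suminf_finite[of "{Y x}"]) auto
  ultimately show ?thesis by simp
qed

lemma expectation_level_sets_eqI:
  fixes h :: "'a \<Rightarrow> real" and h' :: "'b \<Rightarrow> real"
  assumes P: "prob_space P" "h \<in> borel_measurable P" "Y \<in> P \<rightarrow>\<^sub>M count_space (UNIV :: nat set)" "\<And>x. \<bar>h x\<bar> \<le> 1"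
    and Q: "prob_space Q" "h' \<in> borel_measurable Q" "Y' \<in> Q \<rightarrow>\<^sub>M count_space (UNIV :: nat set)" "\<And>x. \<bar>h' x\<bar> \<le> 1"
    and eq: "\<And>t. \<bar>t\<bar> < 1 \<Longrightarrow> (\<integral>x. h x * t ^ Y x \<partial>P) = (\<integral>x. h' x * t ^ Y' x \<partial>Q)"
  shows "(\<integral>x. h x * of_bool (Y x = n) \<partial>P) = (\<integral>x. h' x * of_bool (Y' x = n) \<partial>Q)"
proof -
  have "(\<lambda>n. \<integral>x. h x * of_bool (Y x = n) \<partial>P) = (\<lambda>n. \<integral>x. h' x * of_bool (Y' x = n) \<partial>Q)"
    by (rule powser_coeffs_eqI[OF prob_space.sums_expectation_level_sets[OF P]])
       (simp_all add: eq prob_space.sums_expectation_level_sets[OF Q])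
  then show ?thesis by metis
qed

lemma distr_eq_pmfI_pgf:
  assumes "prob_space P" and X: "X \<in> P \<rightarrow>\<^sub>M count_space (UNIV :: nat set)"
    and eq: "\<And>t :: real. \<bar>t\<bar> \<le> 1 \<Longrightarrow> (\<integral>x. t ^ X x \<partial>P) = measure_pmf.expectation p (\<lambda>n. t ^ n)"
  shows "distr P (count_space UNIV) X = measure_pmf p"
proof (rule measure_eqI_countable[where A=UNIV])
  interpret prob_space P by fact
  fix n :: nat
  have "measure P (X -` {n} \<inter> space P) = (\<integral>x. indicator (X -` {n} \<inter> space P) x \<partial>P)"
    using X by simp
  also have "\<dots> = (\<integral>x. 1 * of_bool (X x = n) \<partial>P)"
    by (intro Bochner_Integration.integral_cong) auto
  also have "\<dots> = measure_pmf.expectation p (\<lambda>x. 1 * of_bool (x = n))"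
    by (rule expectation_level_sets_eqI[where h="\<lambda>_. 1" and h'="\<lambda>_. 1"])
       (use assms in \<open>auto intro: measure_pmf.prob_space_axioms\<close>)
  also have "\<dots> = measure_pmf.expectation p (indicator {n})"
    by (intro Bochner_Integration.integral_cong) auto
  finally have "measure P (X -` {n} \<inter> space P) = pmf p n"
    by (simp add: pmf.rep_eq)
  then show "emeasure (distr P (count_space UNIV) X) {n} = emeasure (measure_pmf p) {n}"
    using X by (simp add: emeasure_distr emeasure_eq_measure emeasure_pmf_single)
qed auto

lemma distr_eq_pmfI_pgf_pair:
  assumes "prob_space P" and X: "X \<in> P \<rightarrow>\<^sub>M count_space UNIV" and Y: "Y \<in> P \<rightarrow>\<^sub>M count_space UNIV"
    and eq: "\<And>s t :: real. \<bar>s\<bar> \<le> 1 \<Longrightarrow> \<bar>t\<bar> \<le> 1 \<Longrightarrow>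
      (\<integral>x. s ^ X x * t ^ Y x \<partial>P) = measure_pmf.expectation p (\<lambda>(n, m). s ^ n * t ^ m)"
  shows "distr P (count_space UNIV) (\<lambda>x. (X x, Y x)) = measure_pmf (p :: (nat \<times> nat) pmf)"
proof (rule measure_eqI_countable[where A=UNIV])
  interpret prob_space P by fact
  note [measurable] = X Y
  have [measurable]: "(\<lambda>x. (X x, Y x)) \<in> P \<rightarrow>\<^sub>M count_space UNIV"
    using measurable_Pair[OF X Y] by (simp add: pair_measure_countable)
  fix nm :: "nat \<times> nat"
  obtain n m where nm: "nm = (n, m)" by (cases nm)
  have "(\<integral>x. s ^ X x * of_bool (Y x = m) \<partial>P) = measure_pmf.expectation p (\<lambda>x. s ^ fst x * of_bool (snd x = m))"
    if "\<bar>s\<bar> \<le> 1" for s :: real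
    by (rule expectation_level_sets_eqI)
       (use assms(1-3) that eq[OF that] in
        \<open>auto intro: measure_pmf.prob_space_axioms simp: power_le_one power_abs case_prod_unfold\<close>)
  then have eq2: "(\<integral>x. (of_bool (Y x = m) :: real) * of_bool (X x = n) \<partial>P)
      = measure_pmf.expectation p (\<lambda>x. of_bool (snd x = m) * of_bool (fst x = n))"
    by (intro expectation_level_sets_eqI)
       (use assms(1-3) in \<open>auto intro: measure_pmf.prob_space_axioms simp: mult.commute\<close>)
  let ?A = "(\<lambda>x. (X x, Y x)) -` {nm} \<inter> space P"
  have "measure P ?A = (\<integral>x. indicator ?A x \<partial>P)"
    by simp
  also have "\<dots> = (\<integral>x. of_bool (Y x = m) * of_bool (X x = n) \<partial>P)"
    by (intro Bochner_Integration.integral_cong) (auto simp: nm)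
  also note eq2
  also have "measure_pmf.expectation p (\<lambda>x. (of_bool (snd x = m) :: real) * of_bool (fst x = n))
      = measure_pmf.expectation p (indicator {nm})"
    by (intro Bochner_Integration.integral_cong) (auto simp: nm indicator_def)
  finally have "measure P ?A = pmf p nm"
    by (simp add: pmf.rep_eq)
  then show "emeasure (distr P (count_space UNIV) (\<lambda>x. (X x, Y x))) {nm} = emeasure (measure_pmf p) {nm}"
    by (simp add: emeasure_distr emeasure_eq_measure emeasure_pmf_single)
qed auto

lemma pmf_eqI_pgf:
  assumes "\<And>t :: real. \<bar>t\<bar> \<le> 1 \<Longrightarrow> measure_pmf.expectation p (\<lambda>n. t ^ n) = measure_pmf.expectation q (\<lambda>n :: nat. t ^ n)"
  shows "p = q"
proof -
  have "distr (measure_pmf p) (count_space UNIV) (\<lambda>n. n) = measure_pmf q"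
    using assms by (intro distr_eq_pmfI_pgf measure_pmf.prob_space_axioms) auto
  also have "distr (measure_pmf p) (count_space UNIV) (\<lambda>n. n) = measure_pmf p"
    by (intro distr_id2) auto
  finally show ?thesis by (simp add: measure_pmf_inject)
qed

section \<open>Generating functions of finitely supported laws\<close>

definition finite_pgf :: "(real \<Rightarrow> real) \<Rightarrow> bool" where
  "finite_pgf g \<longleftrightarrow> (\<exists>p :: nat pmf. finite (set_pmf p) \<and> (\<forall>t. g t = measure_pmf.expectation p (\<lambda>n. t ^ n)))"

lemma finite_pgf_1: "finite_pgf (\<lambda>_. 1)"
  unfolding finite_pgf_def by (rule exI[of _ "return_pmf 0"]) simp

lemma finite_pgf_ident: "finite_pgf (\<lambda>t. t)"
  unfolding finite_pgf_def by (rule exI[of _ "return_pmf 1"]) simp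

lemma finite_pgf_mult:
  assumes "finite_pgf f" "finite_pgf g"
  shows "finite_pgf (\<lambda>t. f t * g t)"
proof -
  obtain p q :: "nat pmf" where pq: "finite (set_pmf p)" "finite (set_pmf q)"
    "\<And>t. f t = measure_pmf.expectation p (\<lambda>n. t ^ n)" "\<And>t. g t = measure_pmf.expectation q (\<lambda>n. t ^ n)"
    using assms unfolding finite_pgf_def by metis
  show ?thesis
    unfolding finite_pgf_def
    by (rule exI[of _ "conv_pmf p q"])
       (simp add: pq finite_set_conv_pmf expectation_conv_pmf power_add)
qed

lemma finite_pgf_prod: "(\<And>j. j \<in> A \<Longrightarrow> finite_pgf (g j)) \<Longrightarrow> finite_pgf (\<lambda>t. \<Prod>j\<in>A. g j t)"
  by (induction A rule: infinite_finite_induct) (auto intro: finite_pgf_1 finite_pgf_mult)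

text \<open>This is the generating function of a size that is replaced by 0 with probability \<open>1 - a\<close>.\<close>

lemma finite_pgf_thinned:
  assumes "finite_pgf g" and a: "0 \<le> a" "a \<le> 1"
  shows "finite_pgf (\<lambda>t. 1 - a + a * g t)"
proof -
  obtain p :: "nat pmf" where p: "finite (set_pmf p)" "\<And>t. g t = measure_pmf.expectation p (\<lambda>n. t ^ n)"
    using assms unfolding finite_pgf_def by metis
  let ?q = "bind_pmf (bernoulli_pmf a) (\<lambda>b. if b then p else return_pmf 0)"
  have fin: "finite (set_pmf ?q)"
    using p(1) by (auto split: if_splits)
  have "measure_pmf.expectation ?q (\<lambda>n. t ^ n) = 1 - a + a * g t" for t :: real
    using has_bochner_integral_bind_pmf[OF integrable_measure_pmf_finite[OF fin, of "\<lambda>n. t ^ n"]] a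
    by (auto simp: has_bochner_integral_iff p(2) algebra_simps)
  then show ?thesis
    using fin unfolding finite_pgf_def by metis
qed

section \<open>Parents and children\<close>

context undirected_tree
begin

lemma edge_vertices: "{x, y} \<in> E \<Longrightarrow> x \<in> V" "{x, y} \<in> E \<Longrightarrow> y \<in> V" "{x, y} \<in> E \<Longrightarrow> x \<noteq> y"
  using simple_edges by (fastforce simp: doubleton_eq_iff)+

lemma the_path_edge: "{x, y} \<in> E \<Longrightarrow> the_path x y = [x, y]"
  using edge_vertices[of x y] by (intro path_eqI) (auto simp: is_path_def)

lemma hd_the_path: "u \<in> V \<Longrightarrow> v \<in> V \<Longrightarrow> the_path u v \<noteq> [] \<and> hd (the_path u v) = u"
  using is_path_the_path[of u v] by (simp add: is_path_def)

end

context rooted_tree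
begin

lemma pa_edge: "v \<in> V \<Longrightarrow> v \<noteq> r \<Longrightarrow> {v, pa v} \<in> E \<and> pa v \<notin> ch v"
  using theI'[OF parent_unique(1)] unfolding pa_def by blast

lemma ch_edge: "j \<in> ch v \<Longrightarrow> {v, j} \<in> E"
  by (simp add: ch_def)

lemma ch_eq_neighbours:
  assumes "v \<in> V" "v \<noteq> r"
  shows "ch v = {j. {v, j} \<in> E} - {pa v}"
  using parent_unique(1)[OF assms] pa_edge[OF assms] ch_edge by blast

lemma ch_root_eq_neighbours: "ch r = {j. {r, j} \<in> E}"
proof -
  have "j \<in> ch r" if "{r, j} \<in> E" for j
    using the_path_edge[of j r] edge_vertices[OF that] that by (auto simp: ch_def dsc_def insert_commute)
  then show ?thesis using ch_edge by auto
qed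

lemma ch_imp:
  assumes "j \<in> ch v"
  shows "j \<in> V" "j \<noteq> r" "v \<in> V" "pa j = v" "j \<noteq> v"
proof -
  have e: "{v, j} \<in> E" and d: "j \<in> dsc v"
    using assms by (auto simp: ch_def)
  show V: "j \<in> V" "v \<in> V" "j \<noteq> v"
    using edge_vertices[OF e] by auto
  have "v \<notin> ch j"
    using dsc_length[OF d] dsc_length[of v j] by (auto simp: ch_def)
  have "v \<in> set (the_path j r)"
    using d by (simp add: dsc_def)
  moreover have "the_path r r = [r]"
    using root by (intro path_eqI) (auto simp: is_path_def)
  ultimately show "j \<noteq> r" using V by auto
  then show "pa j = v"
    using parent_unique(1)[OF V(1)] pa_edge[OF V(1)] e \<open>v \<notin> ch j\<close> by (metis insert_commute)
qed

lemma finite_ch: "finite (ch v)"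
  using finite_dsc by (rule finite_subset[rotated]) (auto simp: ch_def)

lemma pa_imp_ch:
  assumes "v \<in> V" "v \<noteq> r"
  shows "v \<in> ch (pa v)" "pa v \<in> V"
proof -
  show p: "pa v \<in> V"
    using pa_edge[OF assms] edge_vertices by blast
  show "v \<in> ch (pa v)"
    using pa_edge[OF assms] path_pa[OF assms] hd_the_path[OF p root]
      edge_vertices[of v "pa v"] assms hd_in_set[of "the_path (pa v) r"]
    by (auto simp: ch_def dsc_def insert_commute)
qed

lemma pa_eq_hd_tl: "v \<in> V \<Longrightarrow> v \<noteq> r \<Longrightarrow> pa v = hd (tl (the_path v r))"
  using path_pa hd_the_path[OF pa_imp_ch(2) root] by simp

section \<open>Root independence of the exponent\<close>

text \<open>The recursion of \<^const>\<open>eta\<close> with a separate argument at each vertex, as needed for joint generating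
  functions.\<close>

function weighted_eta :: "('a set \<Rightarrow> real) \<Rightarrow> ('a \<Rightarrow> real) \<Rightarrow> 'a \<Rightarrow> real" where
  "weighted_eta \<alpha> \<tau> v = \<tau> v * (\<Prod>j\<in>ch v. 1 - \<alpha> {v, j} + \<alpha> {v, j} * weighted_eta \<alpha> \<tau> j)"
  by auto
termination
  by (relation "Wellfounded.measure (\<lambda>(\<alpha>, \<tau>, v). card (dsc v))") (auto intro: card_dsc_ch)

declare weighted_eta.simps [simp del]

lemma ch_induct [case_names children]:
  assumes "\<And>v. (\<And>j. j \<in> ch v \<Longrightarrow> Q j) \<Longrightarrow> Q v"
  shows "Q v"
  by (induction "card (dsc v)" arbitrary: v rule: less_induct) (blast intro: assms card_dsc_ch)

lemma weighted_eta_const: "weighted_eta \<alpha> (\<lambda>_. t) v = eta \<alpha> v t"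
proof (induction v rule: ch_induct)
  case (children v)
  then show ?case
    by (simp add: weighted_eta.simps[of _ _ v] eta.simps[of _ v])
qed

lemma weighted_eta_cong_dsc:
  assumes "\<And>u. u = v \<or> u \<in> dsc v \<Longrightarrow> \<tau> u = \<tau>' u"
  shows "weighted_eta \<alpha> \<tau> v = weighted_eta \<alpha> \<tau>' v"
  using assms
proof (induction v rule: ch_induct)
  case (children v)
  have "weighted_eta \<alpha> \<tau> j = weighted_eta \<alpha> \<tau>' j" if "j \<in> ch v" for j
    using that children.prems by (intro children.IH) (auto simp: ch_def intro: dsc_trans)
  then show ?case
    using children.prems by (simp add: weighted_eta.simps[of _ _ v])
qed

lemma not_dsc_root: "u \<in> V \<Longrightarrow> r \<notin> dsc u"
proof
  assume "u \<in> V" "r \<in> dsc u"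
  moreover have "the_path r r = [r]"
    using root by (intro path_eqI) (auto simp: is_path_def)
  ultimately show False by (auto simp: dsc_def)
qed

text \<open>The rate of the Poisson variable that is added at the vertex \<open>v\<close>.\<close>

definition innovation_rate :: "real \<Rightarrow> ('a set \<Rightarrow> real) \<Rightarrow> 'a \<Rightarrow> real" where
  "innovation_rate lam \<alpha> v = (if v = r then lam else lam * (1 - \<alpha> {pa v, v}))"

text \<open>Up to an additive constant, the logarithm of the joint probability generating function.\<close>

definition pgf_exponent :: "real \<Rightarrow> ('a set \<Rightarrow> real) \<Rightarrow> ('a \<Rightarrow> real) \<Rightarrow> real" where
  "pgf_exponent lam \<alpha> \<tau> = (\<Sum>u\<in>V. innovation_rate lam \<alpha> u * weighted_eta \<alpha> \<tau> u)"

end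

text \<open>Any two vertices are connected by a path, so that invariance under moving the root along one edge suffices.\<close>

locale adjacent_roots = R: rooted_tree V E r + C: rooted_tree V E c
  for V :: "'a set" and E r c +
  assumes adjacent: "{r, c} \<in> E"
begin

text \<open>The paths from \<open>u\<close> to the two roots differ only at their ends, hence share their second vertex, the parent
  of \<open>u\<close>.\<close>

lemma pa_eq:
  assumes u: "u \<in> V" "u \<noteq> r" "u \<noteq> c"
  shows "R.pa u = C.pa u"
proof -
  have cr: "R.the_path c r = [c, r]"
    using adjacent by (intro R.the_path_edge) (simp add: insert_commute)
  have P: "is_path V E u r (R.the_path u r)"
    by (rule R.is_path_the_path[OF u(1) R.root])
  have "hd (tl (R.the_path u r)) = hd (tl (R.the_path u c))"
  proof (cases "c \<in> set (R.the_path u r)")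
    case True
    then obtain xs ys where eq: "R.the_path u r = xs @ c # ys"
      by (meson split_list)
    then have "ys = [r]"
      using R.path_suffix[OF u(1) R.root eq] cr by simp
    then have eq: "R.the_path u r = xs @ [c, r]" using eq by simp
    have "xs \<noteq> []" using P u eq by (auto simp: is_path_def)
    moreover have "R.the_path u c = xs @ [c]"
      using P eq \<open>xs \<noteq> []\<close> by (intro R.path_eqI u C.root) (auto simp: is_path_def successively_append_iff)
    ultimately show ?thesis
      using eq by (cases xs; cases "tl xs") auto
  next
    case False
    then have "R.the_path u c = R.the_path u r @ [c]"
      using P adjacent C.root by (intro R.path_eqI u) (auto simp: is_path_def successively_append_iff)
    moreover have "tl (R.the_path u r) \<noteq> []"
      using P u by (cases "R.the_path u r") (auto simp: is_path_def)
    ultimately show ?thesis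
      using P by (simp add: is_path_def)
  qed
  then show ?thesis
    using u by (simp add: R.pa_eq_hd_tl C.pa_eq_hd_tl)
qed

lemma pa_root: "R.pa c = r" "C.pa r = c"
proof -
  show "R.pa c = r"
    using adjacent by (intro R.ch_imp) (simp add: R.ch_root_eq_neighbours)
  show "C.pa r = c"
    using adjacent by (intro C.ch_imp) (simp add: C.ch_root_eq_neighbours insert_commute)
qed

lemma weighted_eta_eq:
  "u \<in> V \<Longrightarrow> u \<noteq> r \<Longrightarrow> u \<noteq> c \<Longrightarrow> R.weighted_eta \<alpha> \<tau> u = C.weighted_eta \<alpha> \<tau> u"
proof (induction u rule: R.ch_induct)
  case (children u)
  have ch: "R.ch u = C.ch u"
    using children.prems by (simp add: R.ch_eq_neighbours C.ch_eq_neighbours pa_eq)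
  have "R.weighted_eta \<alpha> \<tau> j = C.weighted_eta \<alpha> \<tau> j" if "j \<in> R.ch u" for j
    using children.IH[OF that] R.ch_imp[OF that] pa_root(1) children.prems by auto
  then show ?case
    by (simp add: R.weighted_eta.simps[of _ _ u] C.weighted_eta.simps[of _ _ u] ch)
qed

text \<open>Only the terms of \<open>r\<close> and \<open>c\<close> depend on which of the two is the root.  Let \<open>A\<close> and \<open>B\<close> be the
  generating functions of the two sides of the edge and \<open>a\<close> its parameter.  Root \<open>r\<close> contributes
  \<open>A (1 - a + a B) + (1 - a) B\<close>, which is symmetric in \<open>A\<close> and \<open>B\<close>.\<close>

lemma pgf_exponent_eq: "R.pgf_exponent lam \<alpha> \<tau> = C.pgf_exponent lam \<alpha> \<tau>"
proof -
  have rc: "r \<in> V" "c \<in> V" "r \<noteq> c"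
    using R.edge_vertices[OF adjacent] by auto
  define a where "a = \<alpha> {r, c}"
  define A where "A = C.weighted_eta \<alpha> \<tau> r"
  define B where "B = R.weighted_eta \<alpha> \<tau> c"
  have ch_r: "R.ch r = insert c (C.ch r)" "c \<notin> C.ch r"
    using adjacent rc by (auto simp: R.ch_root_eq_neighbours C.ch_eq_neighbours pa_root)
  have ch_c: "C.ch c = insert r (R.ch c)" "r \<notin> R.ch c"
    using adjacent rc by (auto simp: C.ch_root_eq_neighbours R.ch_eq_neighbours pa_root insert_commute)
  have "R.weighted_eta \<alpha> \<tau> j = C.weighted_eta \<alpha> \<tau> j" if "j \<in> C.ch r" for j
    using that C.ch_imp[OF that] ch_r by (intro weighted_eta_eq) auto
  then have r: "R.weighted_eta \<alpha> \<tau> r = A * (1 - a + a * B)"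
    by (simp add: R.weighted_eta.simps[of _ _ r] A_def C.weighted_eta.simps[of _ _ r]
        ch_r C.finite_ch B_def a_def)
  have "R.weighted_eta \<alpha> \<tau> j = C.weighted_eta \<alpha> \<tau> j" if "j \<in> R.ch c" for j
    using that R.ch_imp[OF that] ch_c by (intro weighted_eta_eq) auto
  then have c: "C.weighted_eta \<alpha> \<tau> c = B * (1 - a + a * A)"
    by (simp add: C.weighted_eta.simps[of _ _ c] B_def R.weighted_eta.simps[of _ _ c]
        ch_c R.finite_ch A_def a_def insert_commute)
  let ?W = "V - {r, c}"
  have split: "(\<Sum>u\<in>V. f u) = f r + f c + (\<Sum>u\<in>?W. f u)" for f :: "'a \<Rightarrow> real"
    using sum.subset_diff[of "{r, c}" V f] R.finite_vertices rc by simp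
  have rest: "(\<Sum>u\<in>?W. R.innovation_rate lam \<alpha> u * R.weighted_eta \<alpha> \<tau> u)
      = (\<Sum>u\<in>?W. C.innovation_rate lam \<alpha> u * C.weighted_eta \<alpha> \<tau> u)"
    by (intro sum.cong) (auto simp: R.innovation_rate_def C.innovation_rate_def pa_eq weighted_eta_eq)
  have rates: "R.innovation_rate lam \<alpha> r = lam" "R.innovation_rate lam \<alpha> c = lam * (1 - a)"
      "C.innovation_rate lam \<alpha> c = lam" "C.innovation_rate lam \<alpha> r = lam * (1 - a)"
    using rc by (simp_all add: R.innovation_rate_def C.innovation_rate_def pa_root a_def insert_commute)
  show ?thesis
    unfolding R.pgf_exponent_def C.pgf_exponent_def split r c rates rest A_def[symmetric] B_def[symmetric]
    by (simp add: algebra_simps)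
qed

end

lemma (in undirected_tree) pgf_exponent_root_irrelevant:
  assumes "r \<in> V" "v \<in> V"
  shows "rooted_tree.pgf_exponent V E r lam \<alpha> \<tau> = rooted_tree.pgf_exponent V E v lam \<alpha> \<tau>"
  using assms(1)
proof (induction "length (the_path r v)" arbitrary: r rule: less_induct)
  case less
  interpret T: rooted_tree V E v
    using assms(2) by unfold_locales
  show ?case
  proof (cases "r = v")
    case False
    interpret adjacent_roots V E r "T.pa r"
      using less.prems False T.pa_edge T.pa_imp_ch by unfold_locales auto
    have "R.pgf_exponent lam \<alpha> \<tau> = C.pgf_exponent lam \<alpha> \<tau>"
      by (rule pgf_exponent_eq)
    also have "\<dots> = T.pgf_exponent lam \<alpha> \<tau>"
      using T.path_pa[OF less.prems False] C.root by (intro less.hyps) auto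
    finally show ?thesis .
  qed simp
qed

section \<open>Expectations over the thinning variables\<close>

text \<open>Outside the index set \<open>A\<close> the coordinate is the constant \<^const>\<open>undefined\<close>, hence measurable too; this
  allows the count at a vertex to be viewed as a function on any subfamily of the Bernoulli variables that
  determines it.\<close>

lemma measurable_PiM_pmf_coordinate:
  fixes F :: "'i \<Rightarrow> 'c pmf"
  shows "(\<lambda>x. x p) \<in> PiM A (\<lambda>i. measure_pmf (F i)) \<rightarrow>\<^sub>M count_space UNIV"
proof (cases "p \<in> A")
  case True
  have "(\<lambda>x. x p) \<in> PiM A (\<lambda>i. measure_pmf (F i)) \<rightarrow>\<^sub>M measure_pmf (F p)"
    using True by (rule measurable_component_singleton)
  then show ?thesis
    by (simp cong: measurable_cong_sets)
next
  case False
  have "(\<lambda>x. x p) \<in> PiM A (\<lambda>i. measure_pmf (F i)) \<rightarrow>\<^sub>M count_space UNIV \<longleftrightarrow>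
      (\<lambda>x. undefined :: 'c) \<in> PiM A (\<lambda>i. measure_pmf (F i)) \<rightarrow>\<^sub>M count_space UNIV"
    using False by (intro measurable_cong) (auto simp: space_PiM PiE_def extensional_def)
  then show ?thesis by simp
qed

lemma indep_vars_PiM_coordinates:
  assumes M: "\<And>i. i \<in> I \<Longrightarrow> prob_space (M i)" and "I \<noteq> {}"
  shows "prob_space.indep_vars (PiM I M) M (\<lambda>i x. x i) I"
proof -
  interpret prob_space "PiM I M"
    using M by (rule prob_space_PiM)
  have "distr (PiM I M) (PiM I M) (\<lambda>x. \<lambda>i\<in>I. x i) = distr (PiM I M) (PiM I M) (\<lambda>x. x)"
    by (intro distr_cong) (auto simp: space_PiM)
  also have "\<dots> = PiM I M"
    by (rule distr_id)
  also have "\<dots> = PiM I (\<lambda>i. distr (PiM I M) (M i) (\<lambda>x. x i))"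
    by (intro PiM_cong distr_PiM_component[symmetric] M) auto
  finally show ?thesis
    by (subst indep_vars_iff_distr_eq_PiM') (auto simp: \<open>I \<noteq> {}\<close>)
qed

lemma expectation_bernoulli_power:
  "0 \<le> a \<Longrightarrow> a \<le> 1 \<Longrightarrow> measure_pmf.expectation (bernoulli_pmf a) (\<lambda>b. (q::real) ^ of_bool b) = 1 - a + a * q"
  by (simp add: algebra_simps)

lemma abs_convex_le_1:
  fixes a x :: real
  assumes "\<bar>x\<bar> \<le> 1" "0 \<le> a" "a \<le> 1"
  shows "\<bar>1 - a + a * x\<bar> \<le> 1"
proof -
  have "\<bar>a * x\<bar> \<le> a"
    using assms by (simp add: abs_mult mult_left_le)
  then show ?thesis using assms by linarith
qed

abbreviation bernoulli_space :: "'e set \<Rightarrow> ('e \<Rightarrow> real) \<Rightarrow> ('e \<times> nat \<Rightarrow> bool) measure" where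
  "bernoulli_space E \<alpha> \<equiv> (\<Pi>\<^sub>M (e, i)\<in>E \<times> UNIV. measure_pmf (bernoulli_pmf (\<alpha> e)))"

lemma bernoulli_space_eq:
  "bernoulli_space E \<alpha> = PiM (E \<times> UNIV) (\<lambda>p. measure_pmf (bernoulli_pmf (\<alpha> (fst p))))"
  by (simp add: case_prod_unfold)

lemma prob_space_bernoulli_space: "prob_space (bernoulli_space E \<alpha>)"
  unfolding bernoulli_space_eq by (intro prob_space_PiM measure_pmf.prob_space_axioms)

text \<open>Given everything that does not involve the Bernoulli variables of the edge \<open>e\<close>, the thinned count
  is binomial with \<open>K\<close> trials, so integrating these variables out replaces \<open>q\<close> by the Bernoulli generating
  function in \<open>q\<close>.  The proof conditions on the value of \<open>K\<close>; the bound \<open>b\<close> keeps this a finite sum.\<close>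

lemma expectation_thinning:
  fixes Y :: "('e \<times> nat \<Rightarrow> bool) \<Rightarrow> real" and K :: "('e \<times> nat \<Rightarrow> bool) \<Rightarrow> nat"
  assumes A_def: "A = (E - {e}) \<times> (UNIV :: nat set)" and e: "e \<in> E" and \<alpha>: "0 \<le> \<alpha> e" "\<alpha> e \<le> 1"
    and Y: "Y \<in> borel_measurable (PiM A (\<lambda>p. measure_pmf (bernoulli_pmf (\<alpha> (fst p)))))"
      "\<And>I. Y (restrict I A) = Y I" "\<And>I. \<bar>Y I\<bar> \<le> 1"
    and K: "K \<in> PiM A (\<lambda>p. measure_pmf (bernoulli_pmf (\<alpha> (fst p)))) \<rightarrow>\<^sub>M count_space UNIV"
      "\<And>I. K (restrict I A) = K I" "\<And>I. K I \<le> b"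
    and q: "\<bar>q\<bar> \<le> 1"
  shows "(\<integral>I. Y I * q ^ (\<Sum>i<K I. of_bool (I (e, i))) \<partial>bernoulli_space E \<alpha>)
       = (\<integral>I. Y I * (1 - \<alpha> e + \<alpha> e * q) ^ K I \<partial>bernoulli_space E \<alpha>)"
proof -
  let ?F = "\<lambda>p. measure_pmf (bernoulli_pmf (\<alpha> (fst p)))"
  let ?M = "PiM (E \<times> (UNIV :: nat set)) ?F"
  let ?c = "1 - \<alpha> e + \<alpha> e * q"
  interpret prob_space ?M
    by (intro prob_space_PiM measure_pmf.prob_space_axioms)
  have indep: "indep_vars ?F (\<lambda>p x. x p) (E \<times> UNIV)"
    using e by (intro indep_vars_PiM_coordinates measure_pmf.prob_space_axioms) auto
  have restr: "(\<lambda>I. restrict I A) \<in> ?M \<rightarrow>\<^sub>M PiM A ?F"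
    unfolding A_def by (rule measurable_restrict_subset) auto
  have [measurable]: "Y \<in> borel_measurable ?M" "K \<in> ?M \<rightarrow>\<^sub>M count_space UNIV"
    using measurable_compose[OF restr Y(1)] measurable_compose[OF restr K(1)] Y(2) K(2) by simp_all
  have [measurable]: "(\<lambda>I. I p) \<in> ?M \<rightarrow>\<^sub>M count_space UNIV" for p
    by (rule measurable_PiM_pmf_coordinate)
  define T where "T n I = (\<Prod>i<n. q ^ of_bool (I (e, i)))" for n and I :: "'e \<times> nat \<Rightarrow> bool"
  have T_eq: "T n I = q ^ (\<Sum>i<n. of_bool (I (e, i)))" for n I
    unfolding T_def by (simp only: power_sum)
  have T_le: "\<bar>T n I\<bar> \<le> 1" for n I
    using q by (simp add: T_eq power_abs power_le_one)
  have T_meas: "T n \<in> borel_measurable (PiM B ?F)" for n B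
    unfolding T_def
    by (intro borel_measurable_prod measurable_compose[OF measurable_PiM_pmf_coordinate]) simp
  have ET: "expectation (T n) = ?c ^ n" for n
  proof -
    let ?J = "{e} \<times> {..<n}"
    have "indep_vars (\<lambda>_. borel) (\<lambda>p x. q ^ of_bool (x p) :: real) ?J"
      by (rule indep_vars_compose2[OF indep_vars_subset[OF indep]]) (use e in auto)
    then have "expectation (\<lambda>I. \<Prod>p\<in>?J. q ^ of_bool (I p)) = (\<Prod>p\<in>?J. expectation (\<lambda>I. q ^ of_bool (I p)))"
      using q by (intro indep_vars_lebesgue_integral)
        (auto intro!: integrable_const_bound[where B=1] simp: power_abs power_le_one)
    also have "expectation (\<lambda>I. q ^ of_bool (I p)) = ?c" if "p \<in> ?J" for p
    proof -
      have "expectation (\<lambda>I. q ^ of_bool (I p)) = (\<integral>x. q ^ of_bool x \<partial>distr ?M (?F p) (\<lambda>I. I p))"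
        using that e by (subst integral_distr) auto
      also have "\<dots> = (\<integral>x. q ^ of_bool x \<partial>?F p)"
        using that e by (subst distr_PiM_component) (auto intro: measure_pmf.prob_space_axioms)
      also have "\<dots> = ?c"
        using that expectation_bernoulli_power[OF \<alpha>] by (simp only: mem_Times_iff singleton_iff)
      finally show ?thesis .
    qed
    then have "(\<Prod>p\<in>?J. expectation (\<lambda>I. q ^ of_bool (I p))) = ?c ^ n"
      by simp
    also have "(\<lambda>I. \<Prod>p\<in>?J. q ^ of_bool (I p)) = T n"
    proof -
      have "?J = Pair e ` {..<n}"
        by auto
      then show ?thesis
        by (simp add: fun_eq_iff T_def prod.reindex inj_on_def)
    qed
    finally show ?thesis .
  qed
  have *: "expectation (\<lambda>I. (Y I * of_bool (K I = n)) * T n I)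
      = expectation (\<lambda>I. Y I * of_bool (K I = n)) * expectation (T n)" for n
  proof (rule indep_var_lebesgue_integral)
    let ?B = "{e} \<times> (UNIV :: nat set)"
    have "indep_var (PiM A ?F) (\<lambda>\<omega>. restrict (\<lambda>p. \<omega> p) A) (PiM ?B ?F) (\<lambda>\<omega>. restrict (\<lambda>p. \<omega> p) ?B)"
      by (rule indep_var_restrict[OF indep]) (use e in \<open>auto simp: A_def\<close>)
    moreover have "(\<lambda>I. Y I * of_bool (K I = n)) \<in> borel_measurable (PiM A ?F)"
      using Y(1) K(1) by measurable
    ultimately have "indep_var borel ((\<lambda>I. Y I * of_bool (K I = n)) \<circ> (\<lambda>\<omega>. restrict (\<lambda>p. \<omega> p) A))
        borel (T n \<circ> (\<lambda>\<omega>. restrict (\<lambda>p. \<omega> p) ?B))"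
      by (rule indep_var_compose[OF _ _ T_meas])
    then show "indep_var borel (\<lambda>I. Y I * of_bool (K I = n)) borel (T n)"
      by (simp add: comp_def Y K T_def[abs_def])
  next
    show "integrable ?M (\<lambda>I. Y I * of_bool (K I = n))"
      using Y(3) by (intro integrable_const_bound[where B=1]) (auto simp: abs_mult)
    show "integrable ?M (T n)"
      using T_le T_meas by (intro integrable_const_bound[where B=1]) auto
  qed
  have split: "Y I * f (K I) = (\<Sum>n\<le>b. Y I * of_bool (K I = n) * f n)" for f :: "nat \<Rightarrow> real" and I
  proof -
    have "(\<Sum>n\<le>b. Y I * of_bool (K I = n) * f n) = (\<Sum>n\<in>{K I}. Y I * of_bool (K I = n) * f n)"
      using K(3)[of I] by (intro sum.mono_neutral_right) auto
    then show ?thesis by simp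
  qed
  have "\<bar>Y I * of_bool (K I = n) * T n I\<bar> \<le> 1" "\<bar>Y I * of_bool (K I = n)\<bar> \<le> 1" for n I
    using Y(3)[of I] T_le[of n I] by (auto simp: abs_mult intro!: mult_le_one)
  then have int: "integrable ?M (\<lambda>I. Y I * of_bool (K I = n) * T n I)" "integrable ?M (\<lambda>I. Y I * of_bool (K I = n))" for n
    using T_meas[of n "E \<times> UNIV"] by (auto intro!: integrable_const_bound[where B=1])
  have "(\<integral>I. Y I * q ^ (\<Sum>i<K I. of_bool (I (e, i))) \<partial>?M)
      = expectation (\<lambda>I. \<Sum>n\<le>b. Y I * of_bool (K I = n) * T n I)"
    using split[of _ "\<lambda>n. T n _"] by (simp only: T_eq)
  also have "\<dots> = (\<Sum>n\<le>b. expectation (\<lambda>I. Y I * of_bool (K I = n)) * ?c ^ n)"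
    by (simp add: Bochner_Integration.integral_sum int * ET)
  also have "\<dots> = expectation (\<lambda>I. \<Sum>n\<le>b. Y I * of_bool (K I = n) * ?c ^ n)"
    by (simp add: Bochner_Integration.integral_sum int)
  also have "\<dots> = (\<integral>I. Y I * ?c ^ K I \<partial>?M)"
    using split[of _ "\<lambda>n. ?c ^ n"] by (simp only:)
  finally show ?thesis
    unfolding bernoulli_space_eq .
qed

context rooted_tree
begin

lemma measurable_mpmrf_count:
  assumes L: "\<And>u. (\<lambda>x. L x u) \<in> M \<rightarrow>\<^sub>M count_space UNIV"
    and I: "\<And>p. (\<lambda>x. I x p) \<in> M \<rightarrow>\<^sub>M count_space UNIV"
  shows "(\<lambda>x. mpmrf_count (L x) (I x) u) \<in> M \<rightarrow>\<^sub>M count_space UNIV"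
proof (induction "length (the_path u r)" arbitrary: u rule: less_induct)
  case less
  note [measurable] = L I
  show ?case
  proof (cases "u \<in> V - {r}")
    case True
    then have [measurable]: "(\<lambda>x. mpmrf_count (L x) (I x) (pa u)) \<in> M \<rightarrow>\<^sub>M count_space UNIV"
      by (intro less.hyps) (simp add: path_pa)
    have [measurable]: "(\<lambda>x. \<Sum>i<n. of_bool (I x ({pa u, u}, i)) :: nat) \<in> M \<rightarrow>\<^sub>M count_space UNIV" for n
      by measurable
    have "(\<lambda>x. L x u + (\<Sum>i<mpmrf_count (L x) (I x) (pa u). of_bool (I x ({pa u, u}, i))))
        \<in> M \<rightarrow>\<^sub>M count_space UNIV"
      by (rule measurable_compose_countable[where g="\<lambda>x. mpmrf_count (L x) (I x) (pa u)"]) measurable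
    then show ?thesis
      using True by (simp add: mpmrf_count.simps[of _ _ u])
  next
    case False
    then have "mpmrf_count (L x) (I x) u = L x u" for x
      by (subst mpmrf_count.simps) auto
    then show ?thesis
      using L by simp
  qed
qed

lemma mpmrf_count_bounded: "\<exists>b. \<forall>I. mpmrf_count L I u \<le> b"
proof (induction "length (the_path u r)" arbitrary: u rule: less_induct)
  case less
  show ?case
  proof (cases "u \<in> V - {r}")
    case True
    then obtain b where b: "\<And>I. mpmrf_count L I (pa u) \<le> b"
      using less.hyps[of "pa u"] path_pa[of u] by auto
    have "mpmrf_count L I u \<le> L u + b" for I
    proof -
      have "(\<Sum>i<mpmrf_count L I (pa u). of_bool (I ({pa u, u}, i))) \<le> (\<Sum>i<mpmrf_count L I (pa u). 1 :: nat)"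
        by (intro sum_mono) auto
      then show ?thesis
        using True b[of I] by (simp add: mpmrf_count.simps[of _ _ u])
    qed
    then show ?thesis by blast
  next
    case False
    then show ?thesis
      by (auto simp: mpmrf_count.simps[of _ _ u])
  qed
qed

lemma mpmrf_count_cong_edges:
  assumes "S \<subseteq> V" "\<And>x. x \<in> S \<Longrightarrow> x \<noteq> r \<Longrightarrow> pa x \<in> S"
    and eq: "\<And>x i. x \<in> S \<Longrightarrow> x \<noteq> r \<Longrightarrow> I ({pa x, x}, i) = I' ({pa x, x}, i)"
    and "u \<in> S"
  shows "mpmrf_count L I u = mpmrf_count L I' u"
  using \<open>u \<in> S\<close>
proof (induction "length (the_path u r)" arbitrary: u rule: less_induct)
  case less
  show ?case
  proof (cases "u = r")
    case False
    then have "mpmrf_count L I (pa u) = mpmrf_count L I' (pa u)"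
      using less.prems assms(1,2) path_pa[of u] by (intro less.hyps) auto
    then show ?thesis
      using False eq[OF less.prems] by (simp add: mpmrf_count.simps[of _ _ u])
  qed (simp add: mpmrf_count.simps[of _ _ r])
qed

lemma abs_weighted_eta_le_1:
  assumes \<alpha>: "\<And>e. e \<in> E \<Longrightarrow> 0 \<le> \<alpha> e \<and> \<alpha> e \<le> 1" and \<tau>: "\<And>u. \<bar>\<tau> u\<bar> \<le> 1"
  shows "\<bar>weighted_eta \<alpha> \<tau> u\<bar> \<le> 1"
proof (induction u rule: ch_induct)
  case (children v)
  have "\<bar>1 - \<alpha> {v, j} + \<alpha> {v, j} * weighted_eta \<alpha> \<tau> j\<bar> \<le> 1" if "j \<in> ch v" for j
    using abs_convex_le_1 children[OF that] \<alpha>[OF ch_edge[OF that]] by auto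
  then show ?case
    using \<tau> by (auto simp: weighted_eta.simps[of _ _ v] abs_mult abs_prod intro!: mult_le_one prod_le_1 prod_nonneg)
qed

text \<open>For fixed \<open>L\<close>, the leaves are integrated out successively.  The set \<open>S\<close> consists of the vertices
  that are still present; the factors of the children already removed are absorbed into the factor of their
  parent, which is what \<open>pruned\<close> records.  Removing a deepest vertex of \<open>S\<close>, all of whose children are
  gone, produces the full value of \<^const>\<open>weighted_eta\<close> at that vertex.\<close>

lemma expectation_thinnings:
  fixes L :: "'a \<Rightarrow> nat"
  assumes \<alpha>: "\<And>e. e \<in> E \<Longrightarrow> 0 \<le> \<alpha> e \<and> \<alpha> e \<le> 1" and \<tau>: "\<And>u. \<bar>\<tau> u\<bar> \<le> 1"
    and "S \<subseteq> V" "\<And>u. u \<in> S \<Longrightarrow> u \<noteq> r \<Longrightarrow> pa u \<in> S"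
  defines "pruned \<equiv> (\<lambda>S u. \<tau> u * (\<Prod>j\<in>ch u - S. 1 - \<alpha> {u, j} + \<alpha> {u, j} * weighted_eta \<alpha> \<tau> j))"
  shows "(\<integral>I. (\<Prod>u\<in>S. pruned S u ^ mpmrf_count L I u) \<partial>bernoulli_space E \<alpha>) = (\<Prod>u\<in>S. weighted_eta \<alpha> \<tau> u ^ L u)"
proof -
  let ?F = "\<lambda>p :: 'a set \<times> nat. measure_pmf (bernoulli_pmf (\<alpha> (fst p)))"
  note eta_le = abs_weighted_eta_le_1[OF \<alpha> \<tau>]
  have factor_le: "\<bar>1 - \<alpha> {u, j} + \<alpha> {u, j} * weighted_eta \<alpha> \<tau> j\<bar> \<le> 1" if "j \<in> ch u" for u j
    using abs_convex_le_1 eta_le \<alpha>[OF ch_edge[OF that]] by auto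
  have pruned_le: "\<bar>pruned S u\<bar> \<le> 1" for S u
    using \<tau> factor_le unfolding pruned_def
    by (auto simp: abs_mult abs_prod intro!: mult_le_one prod_le_1 prod_nonneg)
  have "finite S"
    using assms(3) finite_vertices by (rule finite_subset)
  then show ?thesis
    using assms(3,4)
  proof (induction "card S" arbitrary: S rule: less_induct)
    case less
    interpret prob_space "bernoulli_space E \<alpha>"
      by (rule prob_space_bernoulli_space)
    show ?case
    proof (cases "S = {}")
      case False
      define depth where "depth u = length (the_path u r)" for u
      obtain j where j: "j \<in> S" "\<And>u. u \<in> S \<Longrightarrow> depth u \<le> depth j"
        using finite_has_maximal[of "depth ` S"] False \<open>finite S\<close>
        by (metis (no_types, lifting) Max_ge Max_in finite_imageI image_iff image_is_empty)
      define S' where "S' = S - {j}"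
      have S: "S = insert j S'" "j \<notin> S'" "finite S'" "S' \<subseteq> V" "j \<in> V"
        using j less.prems by (auto simp: S'_def)
      have depth_pa: "depth (pa u) < depth u" if "u \<in> V" "u \<noteq> r" for u
        using path_pa[OF that] by (simp add: depth_def)
      have S'_closed: "pa u \<in> S'" if "u \<in> S'" "u \<noteq> r" for u
      proof -
        have "pa u \<in> S" using less.prems(3) that by (simp add: S'_def)
        moreover have "pa u \<noteq> j"
          using j(2)[of u] depth_pa[of u] that S by auto
        ultimately show ?thesis by (simp add: S'_def)
      qed
      have IH: "expectation (\<lambda>I. \<Prod>u\<in>S'. pruned S' u ^ mpmrf_count L I u) = (\<Prod>u\<in>S'. weighted_eta \<alpha> \<tau> u ^ L u)"
        using S S'_closed by (intro less.hyps) auto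
      have "ch j \<inter> S = {}"
      proof -
        have "k \<notin> S" if "k \<in> ch j" for k
          using depth_pa[of k] j(2)[of k] ch_imp[OF that] by auto
        then show ?thesis by auto
      qed
      then have pj: "pruned S j = weighted_eta \<alpha> \<tau> j"
        by (simp add: pruned_def weighted_eta.simps[of _ _ j] Diff_triv)
      show ?thesis
      proof (cases "j = r")
        case True
        have "the_path r r = [r]"
          using root by (intro path_eqI) (auto simp: is_path_def)
        then have "depth u \<le> 1" if "u \<in> S'" for u
          using j(2)[of u] that by (simp add: True S depth_def)
        moreover have "1 < depth u" if "u \<in> S'" for u
        proof -
          have u: "u \<in> V" "u \<noteq> r" using that S True by auto
          then have "the_path (pa u) r \<noteq> []"
            using hd_the_path[OF pa_imp_ch(2) root] by blast
          then show ?thesis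
            by (simp add: depth_def path_pa[OF u])
        qed
        ultimately have "S' = {}"
          by fastforce
        then show ?thesis
          using S True pj by (simp add: mpmrf_count.simps[of _ _ r] prob_space)
      next
        case False
        define p where "p = pa j"
        define q where "q = weighted_eta \<alpha> \<tau> j"
        have p: "p \<in> S'" "p \<in> V" "j \<in> ch p"
          using less.prems(3)[OF j(1) False] depth_pa[OF \<open>j \<in> V\<close> False] pa_imp_ch[OF \<open>j \<in> V\<close> False]
          by (auto simp: p_def S'_def)
        define Y where "Y I = (\<Prod>u\<in>S'. pruned S u ^ mpmrf_count L I u)" for I
        \<comment> \<open>The remaining counts do not involve the Bernoulli variables of the edge above \<open>j\<close>.\<close>
        have cnt: "mpmrf_count L (restrict I ((E - {{p, j}}) \<times> UNIV)) u = mpmrf_count L I u" if "u \<in> S'" for I u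
        proof (rule mpmrf_count_cong_edges[OF S(4) S'_closed _ that])
          fix x i assume x: "x \<in> S'" "x \<noteq> r"
          then have "{pa x, x} \<in> E" "depth (pa x) < depth x"
            using pa_edge[of x] depth_pa[of x] S by (auto simp: insert_commute)
          moreover have "{pa x, x} \<noteq> {p, j}"
            using x S \<open>depth (pa x) < depth x\<close> depth_pa[OF \<open>j \<in> V\<close> False] by (auto simp: doubleton_eq_iff p_def)
          ultimately show "restrict I ((E - {{p, j}}) \<times> UNIV) ({pa x, x}, i) = I ({pa x, x}, i)"
            by simp
        qed auto
        have cnt_meas: "(\<lambda>I. mpmrf_count L I u) \<in> PiM B ?F \<rightarrow>\<^sub>M count_space UNIV" for u B
          by (rule measurable_mpmrf_count) (auto intro: measurable_PiM_pmf_coordinate)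
        obtain b where b: "\<And>I. mpmrf_count L I p \<le> b"
          using mpmrf_count_bounded by blast
        have "expectation (\<lambda>I. \<Prod>u\<in>S. pruned S u ^ mpmrf_count L I u)
            = expectation (\<lambda>I. q ^ L j * (Y I * q ^ (\<Sum>i<mpmrf_count L I p. of_bool (I ({p, j}, i)))))"
        proof -
          have "(\<Prod>u\<in>S. pruned S u ^ mpmrf_count L I u) = q ^ mpmrf_count L I j * Y I" for I
            using prod.remove[OF less.prems(1) j(1), of "\<lambda>u. pruned S u ^ mpmrf_count L I u"]
            by (simp only: pj q_def Y_def S'_def)
          moreover have "mpmrf_count L I j = L j + (\<Sum>i<mpmrf_count L I p. of_bool (I ({p, j}, i)))" for I
            using S False by (simp add: mpmrf_count.simps[of _ _ j] p_def)
          ultimately show ?thesis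
            by (simp only: power_add mult_ac)
        qed
        also have "\<dots> = q ^ L j * expectation (\<lambda>I. Y I * q ^ (\<Sum>i<mpmrf_count L I p. of_bool (I ({p, j}, i))))"
          by simp
        also have "expectation (\<lambda>I. Y I * q ^ (\<Sum>i<mpmrf_count L I p. of_bool (I ({p, j}, i))))
            = expectation (\<lambda>I. Y I * (1 - \<alpha> {p, j} + \<alpha> {p, j} * q) ^ mpmrf_count L I p)"
        proof (rule expectation_thinning[OF refl])
          show "{p, j} \<in> E" "0 \<le> \<alpha> {p, j}" "\<alpha> {p, j} \<le> 1"
            using \<alpha> ch_edge[OF p(3)] by auto
          show "Y \<in> borel_measurable (PiM ((E - {{p, j}}) \<times> UNIV) ?F)"
            unfolding Y_def
            by (intro borel_measurable_prod measurable_compose[OF cnt_meas]) simp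
          show "Y (restrict I ((E - {{p, j}}) \<times> UNIV)) = Y I" for I
            by (simp add: Y_def cnt)
          show "\<bar>Y I\<bar> \<le> 1" for I
            using pruned_le by (auto simp: Y_def abs_prod power_abs intro!: prod_le_1 power_le_one)
        qed (use cnt cnt_meas b p eta_le in \<open>auto simp: q_def\<close>)
        also have "(\<lambda>I. Y I * (1 - \<alpha> {p, j} + \<alpha> {p, j} * q) ^ mpmrf_count L I p)
            = (\<lambda>I. \<Prod>u\<in>S'. pruned S' u ^ mpmrf_count L I u)"
        proof
          fix I
          have "ch p - S' = insert j (ch p - S)" "finite (ch p - S)" "j \<notin> ch p - S"
            using p S finite_ch by auto
          then have "pruned S' p = pruned S p * (1 - \<alpha> {p, j} + \<alpha> {p, j} * q)"
            by (simp add: pruned_def q_def)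
          moreover have "pruned S' u = pruned S u" if "u \<noteq> p" for u
          proof -
            have "j \<notin> ch u" using ch_imp(4)[of j u] that by (auto simp: p_def)
            then have "ch u - S' = ch u - S" using S by auto
            then show ?thesis by (simp add: pruned_def)
          qed
          ultimately show "Y I * (1 - \<alpha> {p, j} + \<alpha> {p, j} * q) ^ mpmrf_count L I p
              = (\<Prod>u\<in>S'. pruned S' u ^ mpmrf_count L I u)"
            using S(3) p(1) by (simp add: Y_def prod.remove[of S' p] power_mult_distrib mult_ac)
        qed
        finally show ?thesis
          using S IH by (simp add: q_def)
      qed
    qed (simp add: prob_space)
  qed
qed

end

section \<open>The joint law of a count and the total\<close>

context rooted_tree
begin

lemma weighted_eta_one: "weighted_eta \<alpha> (\<lambda>_. 1) u = 1"
proof (induction u rule: ch_induct)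
  case (children u)
  then show ?case by (simp add: weighted_eta.simps[of _ _ u])
qed

lemma pgf_exponent_one: "pgf_exponent lam \<alpha> (\<lambda>_. 1) = (\<Sum>u\<in>V. innovation_rate lam \<alpha> u)"
  by (simp add: pgf_exponent_def weighted_eta_one)

lemma innovation_rate_pos:
  assumes "0 < lam" "\<And>e. e \<in> E \<Longrightarrow> \<alpha> e < 1" "u \<in> V"
  shows "0 < innovation_rate lam \<alpha> u"
  using assms pa_edge[of u] by (auto simp: innovation_rate_def insert_commute)

lemma measurable_mpmrf_count_source:
  "(\<lambda>x. mpmrf_count (fst x) (snd x) u) \<in> source_space lam \<alpha> \<rightarrow>\<^sub>M count_space UNIV"
  unfolding source_space_def bernoulli_space_eq
  by (intro measurable_mpmrf_count measurable_compose[OF measurable_fst measurable_PiM_pmf_coordinate]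
      measurable_compose[OF measurable_snd measurable_PiM_pmf_coordinate])

text \<open>After the thinning variables are integrated out, the remaining integrand is a product over the independent
  Poisson variables.\<close>

lemma expectation_source_space:
  assumes lam: "0 < lam" and \<alpha>: "\<And>e. e \<in> E \<Longrightarrow> 0 \<le> \<alpha> e \<and> \<alpha> e < 1" and \<tau>: "\<And>u. \<bar>\<tau> u\<bar> \<le> 1"
  shows "(\<integral>x. (\<Prod>u\<in>V. \<tau> u ^ mpmrf_count (fst x) (snd x) u) \<partial>source_space lam \<alpha>)
    = exp (pgf_exponent lam \<alpha> \<tau> - pgf_exponent lam \<alpha> (\<lambda>_. 1))"
proof -
  let ?P = "\<lambda>u. measure_pmf (poisson_pmf (innovation_rate lam \<alpha> u))"
  let ?L = "PiM V ?P"
  have source: "source_space lam \<alpha> = ?L \<Otimes>\<^sub>M bernoulli_space E \<alpha>"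
    by (simp add: source_space_def innovation_rate_def)
  interpret L: prob_space ?L
    by (intro prob_space_PiM measure_pmf.prob_space_axioms)
  interpret I: prob_space "bernoulli_space E \<alpha>"
    by (rule prob_space_bernoulli_space)
  interpret LI: pair_prob_space ?L "bernoulli_space E \<alpha>" ..
  interpret P: product_sigma_finite ?P ..
  let ?f = "\<lambda>x. \<Prod>u\<in>V. \<tau> u ^ mpmrf_count (fst x) (snd x) u"
  have "?f \<in> borel_measurable (source_space lam \<alpha>)"
    by (intro borel_measurable_prod measurable_compose[OF measurable_mpmrf_count_source]) simp
  then have int: "integrable (?L \<Otimes>\<^sub>M bernoulli_space E \<alpha>) ?f"
    unfolding source using \<tau>
    by (intro LI.integrable_const_bound[where B=1])
      (auto simp: abs_prod power_abs intro!: prod_le_1 power_le_one)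
  have "(\<integral>x. ?f x \<partial>source_space lam \<alpha>)
      = (\<integral>L. (\<integral>I. (\<Prod>u\<in>V. \<tau> u ^ mpmrf_count L I u) \<partial>bernoulli_space E \<alpha>) \<partial>?L)"
    unfolding source using LI.integral_fst'[OF int] by simp
  also have "\<dots> = (\<integral>L. (\<Prod>u\<in>V. weighted_eta \<alpha> \<tau> u ^ L u) \<partial>?L)"
  proof (rule Bochner_Integration.integral_cong[OF refl])
    fix L :: "'a \<Rightarrow> nat"
    have no_ch: "ch u - V = {}" for u
      using ch_imp(1) by blast
    have "(\<integral>I. (\<Prod>u\<in>V. (\<tau> u * (\<Prod>j\<in>ch u - V. 1 - \<alpha> {u, j} + \<alpha> {u, j} * weighted_eta \<alpha> \<tau> j)) ^ mpmrf_count L I u)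
        \<partial>bernoulli_space E \<alpha>) = (\<Prod>u\<in>V. weighted_eta \<alpha> \<tau> u ^ L u)"
      by (rule expectation_thinnings) (use \<alpha> \<tau> pa_imp_ch(2) in \<open>auto intro: less_imp_le\<close>)
    then show "(\<integral>I. (\<Prod>u\<in>V. \<tau> u ^ mpmrf_count L I u) \<partial>bernoulli_space E \<alpha>)
        = (\<Prod>u\<in>V. weighted_eta \<alpha> \<tau> u ^ L u)"
      by (simp only: no_ch prod.empty mult_1_right)
  qed
  also have "\<dots> = (\<Prod>u\<in>V. \<integral>n. weighted_eta \<alpha> \<tau> u ^ n \<partial>?P u)"
  proof (rule P.product_integral_prod[OF finite_vertices])
    fix u
    have "\<bar>weighted_eta \<alpha> \<tau> u\<bar> \<le> 1"
      using \<alpha> \<tau> by (intro abs_weighted_eta_le_1) (auto intro: less_imp_le)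
    then show "integrable (?P u) (\<lambda>n. weighted_eta \<alpha> \<tau> u ^ n)"
      by (intro measure_pmf.integrable_const_bound[where B=1]) (auto simp: power_abs power_le_one)
  qed
  also have "\<dots> = (\<Prod>u\<in>V. exp (innovation_rate lam \<alpha> u * (weighted_eta \<alpha> \<tau> u - 1)))"
    using \<alpha> \<tau> by (intro prod.cong refl expectation_poisson_power innovation_rate_pos abs_weighted_eta_le_1 lam)
      (auto intro: less_imp_le)
  also have "\<dots> = exp (pgf_exponent lam \<alpha> \<tau> - pgf_exponent lam \<alpha> (\<lambda>_. 1))"
    unfolding pgf_exponent_one
    by (simp add: pgf_exponent_def exp_sum[OF finite_vertices] right_diff_distrib flip: sum_subtractf)
  finally show ?thesis .
qed

end

lemma expectation_mpmrf_power:
  assumes tree: "undirected_tree V E" and lam: "0 < lam"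
    and \<alpha>: "\<And>e. e \<in> E \<Longrightarrow> 0 \<le> \<alpha> e \<and> \<alpha> e < 1" and \<tau>: "\<And>u. \<bar>\<tau> u\<bar> \<le> 1"
    and P: "mpmrf P N lam \<alpha> V E" and v: "v \<in> V"
  shows "(\<integral>\<omega>. (\<Prod>u\<in>V. \<tau> u ^ N u \<omega>) \<partial>P)
    = exp (rooted_tree.pgf_exponent V E v lam \<alpha> \<tau> - rooted_tree.pgf_exponent V E v lam \<alpha> (\<lambda>_. 1))"
proof -
  interpret undirected_tree V E by fact
  let ?M = "\<Pi>\<^sub>M v\<in>V. count_space (UNIV :: nat set)"
  obtain r where r: "r \<in> V"
    and law: "distr P ?M (\<lambda>\<omega>. \<lambda>v\<in>V. N v \<omega>) = rooted_tree.mpmrf_law V E r lam \<alpha>"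
    and N: "\<And>v. v \<in> V \<Longrightarrow> N v \<in> P \<rightarrow>\<^sub>M count_space UNIV"
    using P unfolding mpmrf_def by blast
  interpret rooted_tree V E r
    using r by unfold_locales
  let ?g = "\<lambda>x :: 'a \<Rightarrow> nat. \<Prod>u\<in>V. \<tau> u ^ x u"
  have g: "?g \<in> borel_measurable ?M"
    by (intro borel_measurable_prod measurable_compose[OF measurable_component_singleton]) auto
  have "(\<integral>\<omega>. (\<Prod>u\<in>V. \<tau> u ^ N u \<omega>) \<partial>P) = (\<integral>x. ?g x \<partial>distr P ?M (\<lambda>\<omega>. \<lambda>v\<in>V. N v \<omega>))"
    using N by (subst integral_distr[OF _ g]) (auto intro!: measurable_restrict)
  also have "\<dots> = (\<integral>x. (\<Prod>u\<in>V. \<tau> u ^ mpmrf_count (fst x) (snd x) u) \<partial>source_space lam \<alpha>)"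
    unfolding law mpmrf_law_def case_prod_unfold
    by (subst integral_distr[OF _ g]) (auto intro!: measurable_restrict measurable_mpmrf_count_source)
  also have "\<dots> = exp (pgf_exponent lam \<alpha> \<tau> - pgf_exponent lam \<alpha> (\<lambda>_. 1))"
    by (rule expectation_source_space[OF lam \<alpha> \<tau>])
  finally show ?thesis
    by (simp only: pgf_exponent_root_irrelevant[OF r v])
qed

lemma obtain_weights_pmf:
  fixes c :: "'a \<Rightarrow> real"
  assumes "finite A" "\<And>u. u \<in> A \<Longrightarrow> 0 \<le> c u" "sum c A = 1"
  obtains W where "set_pmf W \<subseteq> A" "\<And>u. u \<in> A \<Longrightarrow> pmf W u = c u"
proof
  let ?f = "\<lambda>u. if u \<in> A then c u else 0"
  have "(\<integral>\<^sup>+u. ennreal (?f u) \<partial>count_space UNIV) = (\<Sum>u\<in>A. ennreal (?f u))"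
    using assms by (intro nn_integral_count_space') auto
  also have "\<dots> = 1"
    using assms by simp
  finally have *: "pmf (embed_pmf ?f) u = ?f u" for u
    using assms by (intro pmf_embed_pmf) auto
  show "set_pmf (embed_pmf ?f) \<subseteq> A"
    by (auto simp: set_pmf_eq *)
  show "pmf (embed_pmf ?f) u = c u" if "u \<in> A" for u
    using that by (simp add: *)
qed

lemma (in rooted_tree) finite_pgf_weighted_eta:
  assumes \<alpha>: "\<And>e. e \<in> E \<Longrightarrow> 0 \<le> \<alpha> e \<and> \<alpha> e \<le> 1"
  shows "finite_pgf (\<lambda>t. weighted_eta \<alpha> (\<lambda>_. t) u)"
proof (induction u rule: ch_induct)
  case (children u)
  then show ?case
    unfolding weighted_eta.simps[of _ _ u] using \<alpha>[OF ch_edge]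
    by (intro finite_pgf_mult finite_pgf_ident finite_pgf_prod finite_pgf_thinned) auto
qed

text \<open>The root is a descendant of no vertex, so its argument enters the value at the root only, and there
  linearly.\<close>

lemma (in rooted_tree) weighted_eta_mark_root:
  assumes "u \<in> V"
  shows "weighted_eta \<alpha> ((\<lambda>_. t)(r := s * t)) u = s ^ of_bool (u = r) * weighted_eta \<alpha> (\<lambda>_. t) u"
proof -
  have *: "weighted_eta \<alpha> ((\<lambda>_. t)(r := s * t)) u = weighted_eta \<alpha> (\<lambda>_. t) u" if "u \<noteq> r" "u \<in> V" for u
    using that not_dsc_root[of u] by (intro weighted_eta_cong_dsc) auto
  show ?thesis
  proof (cases "u = r")
    case True
    have "weighted_eta \<alpha> ((\<lambda>_. t)(r := s * t)) j = weighted_eta \<alpha> (\<lambda>_. t) j" if "j \<in> ch r" for j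
      using ch_imp[OF that] by (intro *)
    then show ?thesis
      using True by (simp add: weighted_eta.simps[of _ _ r])
  qed (use assms * in simp)
qed

text \<open>With the tree rooted at \<open>r\<close>, the pair of the count at \<open>r\<close> and the total is a Poisson number of
  independent clusters.  A cluster starts at the vertex \<open>u\<close> with probability proportional to the rate at \<open>u\<close>
  and then has a size with generating function \<open>eta\<close> at \<open>u\<close>; it contributes 1 to the count at \<open>r\<close> exactly
  if it starts there.  The conclusion also exposes the data that enters the comparison for two roots.\<close>

lemma (in rooted_tree) mpmrf_compound_poisson:
  assumes lam: "0 < lam" and \<alpha>: "\<And>e. e \<in> E \<Longrightarrow> 0 \<le> \<alpha> e \<and> \<alpha> e < 1"
    and "prob_space P" and P: "mpmrf P N lam \<alpha> V E"
  defines "c \<equiv> pgf_exponent lam \<alpha> (\<lambda>_. 1)"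
  obtains W H where "finite (set_pmf W)" "\<And>u. finite (set_pmf (H u))"
    "pmf W r = lam / c"
    "\<And>t. measure_pmf.expectation (H r) (\<lambda>n. t ^ n) = eta \<alpha> r t"
    "\<And>t. measure_pmf.expectation (bind_pmf W H) (\<lambda>n. t ^ n) = pgf_exponent lam \<alpha> (\<lambda>_. t) / c"
    "distr P (count_space UNIV) (\<lambda>\<omega>. (N r \<omega>, \<Sum>u\<in>V. N u \<omega>)) = measure_pmf (compound_poisson c (marked_mixture W H r))"
proof -
  let ?rate = "innovation_rate lam \<alpha>"
  have rate: "0 < ?rate u" if "u \<in> V" for u
    using lam \<alpha> that by (intro innovation_rate_pos) auto
  have c: "c = sum ?rate V"
    by (simp add: c_def pgf_exponent_one)
  have "0 < c"
    unfolding c using rate root finite_vertices by (intro sum_pos) auto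
  obtain W where W: "set_pmf W \<subseteq> V" "\<And>u. u \<in> V \<Longrightarrow> pmf W u = ?rate u / c"
    using obtain_weights_pmf[OF finite_vertices, of "\<lambda>u. ?rate u / c"] rate \<open>0 < c\<close>
    by (auto simp: less_imp_le c simp flip: sum_divide_distrib)
  have finW: "finite (set_pmf W)"
    using W(1) finite_vertices by (rule finite_subset)
  have "\<forall>u. \<exists>p. finite (set_pmf p) \<and> (\<forall>t. weighted_eta \<alpha> (\<lambda>_. t) u = measure_pmf.expectation p (\<lambda>n. t ^ n))"
    using finite_pgf_weighted_eta[of \<alpha>] \<alpha> unfolding finite_pgf_def by (auto simp: less_imp_le)
  then obtain H where H: "\<And>u. finite (set_pmf (H u))"
    "\<And>u t. weighted_eta \<alpha> (\<lambda>_. t) u = measure_pmf.expectation (H u) (\<lambda>n. t ^ n)"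
    by metis
  have pgf: "measure_pmf.expectation (marked_mixture W H r) (\<lambda>(n, m). s ^ n * t ^ m)
      = pgf_exponent lam \<alpha> ((\<lambda>_. t)(r := s * t)) / c" for s t
  proof -
    have "measure_pmf.expectation (marked_mixture W H r) (\<lambda>(n, m). s ^ n * t ^ m)
        = measure_pmf.expectation W (\<lambda>u. s ^ of_bool (u = r) * weighted_eta \<alpha> (\<lambda>_. t) u)"
      by (simp add: expectation_marked_mixture finW H integrable_measure_pmf_finite)
    also have "\<dots> = (\<Sum>u\<in>V. s ^ of_bool (u = r) * weighted_eta \<alpha> (\<lambda>_. t) u * (?rate u / c))"
      using W(1) by (subst integral_measure_pmf_real[OF finite_vertices]) (auto simp: W(2))
    also have "\<dots> = pgf_exponent lam \<alpha> ((\<lambda>_. t)(r := s * t)) / c"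
      unfolding pgf_exponent_def sum_divide_distrib
      by (intro sum.cong) (simp_all only: weighted_eta_mark_root times_divide_eq_right times_divide_eq_left mult.commute)
    finally show ?thesis .
  qed
  show ?thesis
  proof (rule that[OF finW H(1)])
    show "pmf W r = lam / c"
      using W(2)[OF root] by (simp add: innovation_rate_def)
    show "measure_pmf.expectation (H r) (\<lambda>n. t ^ n) = eta \<alpha> r t" for t
      by (simp add: H(2)[symmetric] weighted_eta_const)
    have "bind_pmf W H = map_pmf snd (marked_mixture W H r)"
      by (simp add: marked_mixture_def map_bind_pmf map_pmf_comp)
    then show "measure_pmf.expectation (bind_pmf W H) (\<lambda>n. t ^ n) = pgf_exponent lam \<alpha> (\<lambda>_. t) / c" for t
      using pgf[of 1 t] by (simp add: case_prod_unfold fun_upd_idem)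
    show "distr P (count_space UNIV) (\<lambda>\<omega>. (N r \<omega>, \<Sum>u\<in>V. N u \<omega>))
        = measure_pmf (compound_poisson c (marked_mixture W H r))"
    proof (rule distr_eq_pmfI_pgf_pair[OF \<open>prob_space P\<close>])
      have N: "\<And>v. v \<in> V \<Longrightarrow> N v \<in> P \<rightarrow>\<^sub>M count_space UNIV"
        using P unfolding mpmrf_def by blast
      then show "N r \<in> P \<rightarrow>\<^sub>M count_space UNIV" "(\<lambda>\<omega>. \<Sum>u\<in>V. N u \<omega>) \<in> P \<rightarrow>\<^sub>M count_space UNIV"
        using root by (auto intro: measurable_sum_nat)
      fix s t :: real assume st: "\<bar>s\<bar> \<le> 1" "\<bar>t\<bar> \<le> 1"
      let ?\<tau> = "(\<lambda>_. t)(r := s * t)"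
      have "s ^ N r \<omega> * t ^ (\<Sum>u\<in>V. N u \<omega>) = (\<Prod>u\<in>V. ?\<tau> u ^ N u \<omega>)" for \<omega>
        using root finite_vertices
        by (simp add: prod.remove[of V r] sum.remove[of V r] power_sum power_add power_mult_distrib)
      then have "(\<integral>\<omega>. s ^ N r \<omega> * t ^ (\<Sum>u\<in>V. N u \<omega>) \<partial>P) = exp (pgf_exponent lam \<alpha> ?\<tau> - c)"
        unfolding c_def using st
        by (simp only:, intro expectation_mpmrf_power[OF undirected_tree_axioms lam \<alpha> _ P root])
          (auto simp: abs_mult mult_le_one)
      also have "\<dots> = exp (c * (measure_pmf.expectation (marked_mixture W H r) (\<lambda>(n, m). s ^ n * t ^ m) - 1))"
        using \<open>0 < c\<close> by (simp add: pgf right_diff_distrib)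
      also have "\<dots> = measure_pmf.expectation (compound_poisson c (marked_mixture W H r)) (\<lambda>(n, m). s ^ n * t ^ m)"
        using st \<open>0 < c\<close>
        by (intro expectation_compound_poisson_character[symmetric] finite_set_marked_mixture finW H)
          (auto simp: zero_prod_def power_add abs_mult power_abs power_le_one mult_le_one)
      finally show "(\<integral>\<omega>. s ^ N r \<omega> * t ^ (\<Sum>u\<in>V. N u \<omega>) \<partial>P)
          = measure_pmf.expectation (compound_poisson c (marked_mixture W H r)) (\<lambda>(n, m). s ^ n * t ^ m)" .
    qed
  qed
qed

lemma supermod_nat_supermodular:
  assumes "supermodular (\<zeta> :: real \<times> real \<Rightarrow> real)"
  shows "supermod_nat (\<lambda>(n, m). \<zeta> (real n, real m))"
  unfolding supermod_nat_def
proof (intro allI impI)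
  fix a a' b b' :: nat assume "a \<le> a'" "b \<le> b'"
  then show "(case (a, b') of (n, m) \<Rightarrow> \<zeta> (real n, real m)) + (case (a', b) of (n, m) \<Rightarrow> \<zeta> (real n, real m))
      \<le> (case (a, b) of (n, m) \<Rightarrow> \<zeta> (real n, real m)) + (case (a', b') of (n, m) \<Rightarrow> \<zeta> (real n, real m))"
    using assms[unfolded supermodular_def, rule_format, of "(real a, real b')" "(real a', real b)"]
    by (simp add: inf_prod_def sup_prod_def inf_min sup_max)
qed

section \<open>The comparison of two vertices\<close>

theorem theorem2:
  fixes V :: "'a set" and E :: "'a set set" and lam :: real and \<alpha> :: "'a set \<Rightarrow> real"
    and P :: "'w measure" and N :: "'a \<Rightarrow> 'w \<Rightarrow> nat"
    and Q\<^sub>v :: "'x measure" and H\<^sub>v :: "'x \<Rightarrow> nat"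
    and Q\<^sub>w :: "'y measure" and H\<^sub>w :: "'y \<Rightarrow> nat"
  assumes "undirected_tree V E"
    and "lam > 0"
    and "\<forall>e\<in>E. 0 < \<alpha> e \<and> \<alpha> e < 1"
    and "prob_space P"
    and "mpmrf P N lam \<alpha> V E"
    and "v \<in> V" and "w \<in> V"
    and "prob_space Q\<^sub>v" and "H\<^sub>v \<in> Q\<^sub>v \<rightarrow>\<^sub>M count_space UNIV"
    and "\<forall>t\<in>{-1..1}. pgf Q\<^sub>v H\<^sub>v t = rooted_tree.eta V E v \<alpha> v t"
    and "prob_space Q\<^sub>w" and "H\<^sub>w \<in> Q\<^sub>w \<rightarrow>\<^sub>M count_space UNIV"
    and "\<forall>t\<in>{-1..1}. pgf Q\<^sub>w H\<^sub>w t = rooted_tree.eta V E w \<alpha> w t"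
    and "st_le Q\<^sub>v (\<lambda>x. real (H\<^sub>v x)) Q\<^sub>w (\<lambda>y. real (H\<^sub>w y))"
  shows "less_contributing P V (\<lambda>j \<omega>. real (N j \<omega>)) v w"
proof -
  interpret undirected_tree V E by fact
  interpret Tv: rooted_tree V E v by unfold_locales fact
  interpret Tw: rooted_tree V E w by unfold_locales fact
  have \<alpha>: "0 \<le> \<alpha> e \<and> \<alpha> e < 1" if "e \<in> E" for e
    using assms(3) that by (auto intro: less_imp_le)
  have same: "Tv.pgf_exponent lam \<alpha> \<tau> = Tw.pgf_exponent lam \<alpha> \<tau>" for \<tau>
    by (rule pgf_exponent_root_irrelevant[OF \<open>v \<in> V\<close> \<open>w \<in> V\<close>])
  define c where "c = Tw.pgf_exponent lam \<alpha> (\<lambda>_. 1)"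
  obtain Wv Gv where v: "finite (set_pmf Wv)" "\<And>u. finite (set_pmf (Gv u))" "pmf Wv v = lam / c"
    "\<And>t. measure_pmf.expectation (Gv v) (\<lambda>n. t ^ n) = Tv.eta \<alpha> v t"
    "\<And>t. measure_pmf.expectation (bind_pmf Wv Gv) (\<lambda>n. t ^ n) = Tw.pgf_exponent lam \<alpha> (\<lambda>_. t) / c"
    "distr P (count_space UNIV) (\<lambda>\<omega>. (N v \<omega>, \<Sum>u\<in>V. N u \<omega>)) = measure_pmf (compound_poisson c (marked_mixture Wv Gv v))"
    by (rule Tv.mpmrf_compound_poisson[OF \<open>lam > 0\<close> \<alpha> \<open>prob_space P\<close> \<open>mpmrf P N lam \<alpha> V E\<close>, unfolded same, folded c_def]) blast+
  obtain Ww Gw where w: "finite (set_pmf Ww)" "\<And>u. finite (set_pmf (Gw u))" "pmf Ww w = lam / c"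
    "\<And>t. measure_pmf.expectation (Gw w) (\<lambda>n. t ^ n) = Tw.eta \<alpha> w t"
    "\<And>t. measure_pmf.expectation (bind_pmf Ww Gw) (\<lambda>n. t ^ n) = Tw.pgf_exponent lam \<alpha> (\<lambda>_. t) / c"
    "distr P (count_space UNIV) (\<lambda>\<omega>. (N w \<omega>, \<Sum>u\<in>V. N u \<omega>)) = measure_pmf (compound_poisson c (marked_mixture Ww Gw w))"
    by (rule Tw.mpmrf_compound_poisson[OF \<open>lam > 0\<close> \<alpha> \<open>prob_space P\<close> \<open>mpmrf P N lam \<alpha> V E\<close>, folded c_def]) blast+
  have dv: "distr Q\<^sub>v (count_space UNIV) H\<^sub>v = measure_pmf (Gv v)"
    using assms(10) by (intro distr_eq_pmfI_pgf assms) (auto simp: v(4) pgf_def abs_le_iff)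
  have tail_v: "measure_pmf.prob (Gv v) {k<..} = \<P>(x in Q\<^sub>v. real k < real (H\<^sub>v x))" for k
    using assms(9) by (auto simp: measure_distr vimage_def Int_def conj_commute simp flip: dv)
  have dw: "distr Q\<^sub>w (count_space UNIV) H\<^sub>w = measure_pmf (Gw w)"
    using assms(13) by (intro distr_eq_pmfI_pgf assms) (auto simp: w(4) pgf_def abs_le_iff)
  have tail_w: "measure_pmf.prob (Gw w) {k<..} = \<P>(x in Q\<^sub>w. real k < real (H\<^sub>w x))" for k
    using assms(12) by (auto simp: measure_distr vimage_def Int_def conj_commute simp flip: dw)
  have sm: "sm_le_pmf (marked_mixture Wv Gv v) (marked_mixture Ww Gw w)"
  proof (rule sm_le_pmf_marked_mixture)
    \<comment> \<open>The exponent with equal arguments is the same for both roots, hence so is the law of the cluster sizes.\<close>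
    show "bind_pmf Wv Gv = bind_pmf Ww Gw"
      by (rule pmf_eqI_pgf) (simp add: v(5) w(5))
    show "measure_pmf.prob (Gv v) {k<..} \<le> measure_pmf.prob (Gw w) {k<..}" for k
      using assms(14) unfolding tail_v tail_w st_le_def by blast
  qed (simp_all add: v w)
  show ?thesis
    unfolding less_contributing_def sm_le_def
  proof (intro allI impI)
    fix \<zeta> :: "real \<times> real \<Rightarrow> real"
    assume \<zeta>: "supermodular \<zeta>"
      and int: "integrable P (\<lambda>\<omega>. \<zeta> (real (N v \<omega>), \<Sum>j\<in>V. real (N j \<omega>)))"
        "integrable P (\<lambda>\<omega>. \<zeta> (real (N w \<omega>), \<Sum>j\<in>V. real (N j \<omega>)))"
    define f where "f = (\<lambda>(n, m). \<zeta> (real n, real m))"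
    have X: "(\<lambda>\<omega>. (N u \<omega>, \<Sum>j\<in>V. N j \<omega>)) \<in> P \<rightarrow>\<^sub>M count_space UNIV" if "u \<in> V" for u
    proof -
      have "\<And>v. v \<in> V \<Longrightarrow> N v \<in> P \<rightarrow>\<^sub>M count_space UNIV"
        using assms(5) unfolding mpmrf_def by blast
      then have "(\<lambda>\<omega>. (N u \<omega>, \<Sum>j\<in>V. N j \<omega>)) \<in> P \<rightarrow>\<^sub>M count_space UNIV \<Otimes>\<^sub>M count_space UNIV"
        using that by (intro measurable_Pair measurable_sum_nat) auto
      then show ?thesis by (simp add: pair_measure_countable)
    qed
    have f_eq: "\<zeta> (real (N u \<omega>), \<Sum>j\<in>V. real (N j \<omega>)) = f (N u \<omega>, \<Sum>j\<in>V. N j \<omega>)" for u \<omega>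
      by (simp add: f_def)
    have "measure_pmf.expectation (compound_poisson c (marked_mixture Wv Gv v)) f
        \<le> measure_pmf.expectation (compound_poisson c (marked_mixture Ww Gw w)) f"
      using int X[OF \<open>v \<in> V\<close>] X[OF \<open>w \<in> V\<close>] supermod_nat_supermodular[OF \<zeta>] unfolding f_eq
      by (intro compound_poisson_sm_mono sm) (auto simp: integrable_distr_eq f_def simp flip: v(6) w(6))
    then show "(\<integral>\<omega>. \<zeta> (real (N v \<omega>), \<Sum>j\<in>V. real (N j \<omega>)) \<partial>P)
        \<le> (\<integral>\<omega>. \<zeta> (real (N w \<omega>), \<Sum>j\<in>V. real (N j \<omega>)) \<partial>P)"
      unfolding f_eq using X[OF \<open>v \<in> V\<close>] X[OF \<open>w \<in> V\<close>]
      by (simp add: integral_distr flip: v(6) w(6))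
  qed
qed

end
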